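(* Let $\vec k=(k_n,\dots,k_1)\in\{-1,0,1\}^n$. (a) For any $\varepsilon\in\mathbb C(v^{1/N})$, the coefficients in powers of $z$ of the linear combination $\mathsf T^v_{\vec k}(z)_{11}+\varepsilon\,\mathsf T^v_{\vec k}(z)_{22}$ generate a commutative subalgebra of $\mathcal A_n$. Moreover, they lie in the subalgebra of $\mathcal A_n$ generated by $\{\mathsf w_j^{\pm1},(\mathsf D_i/\mathsf D_{i+1})^{\pm1}\}_{1\le i<n}^{1\le j\le n}$. (b) With $s=\sum_{j=1}^n\frac{k_j-1}2$, $$\mathsf T^v_{\vec k}(z)_{11}+\varepsilon\,\mathsf T^v_{\vec k}(z)_{22}=(-1)^n\mathsf w_1\cdots\mathsf w_n\bigl(\hat{\mathsf H}{}_1^{\vec k}z^s-\hat{\mathsf H}{}_2^{\vec k}z^{s+1}+\text{higher powers of }z\bigr),$$ where $\hat{\mathsf H}{}_1^{\vec k}=1+\varepsilon\prod_{j=1}^n\delta_{k_j,1}\prod_{j=1}^n\mathsf w_j^{-2}$ and $$\hat{\mathsf H}{}_2^{\vec k}=\sum_{j=1}^n\mathsf w_j^{-2}+\sum_{i=1}^{n-1}\mathsf w_i^{-k_i-1}\mathsf w_{i+1}^{-k_{i+1}-1}\frac{\mathsf D_i}{\mathsf D_{i+1}}+\sum_{\substack{1\le i<j-1\le n-1\\k_{i+1}=\dots=k_{j-1}=1}}\mathsf w_i^{-k_i-1}\cdots\mathsf w_j^{-k_j-1}\frac{\mathsf D_i}{\mathsf D_j}$$ $$+\varepsilon\Biggl(\sum_{\substack{1\le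 i<j\le n\\k_1=\dots=k_{i-1}=1\\k_{j+1}=\dots=k_n=1}}\mathsf w_1^{-k_1-1}\cdots\mathsf w_i^{-k_i-1}\mathsf w_j^{-k_j-1}\cdots\mathsf w_n^{-k_n-1}\frac{\mathsf D_j}{\mathsf D_i}+\sum_{\substack{1\le j\le n\\k_j=-1,\ k_i=1\,(i\ne j)}}\ \prod_{k\ne j}\mathsf w_k^{-2}\Biggr).$$
   Context: $v$ is an indeterminate and the ground field is $\mathbb C(v^{1/N})$, $N$ a fixed positive integer. $\mathcal A_n$ is the associative $\mathbb C(v^{1/N})$-algebra generated by $\mathsf w_j^{\pm1},\mathsf D_j^{\pm1}$ ($1\le j\le n$) with $[\mathsf w_i,\mathsf w_j]=[\mathsf D_i,\mathsf D_j]=0$, $\mathsf D_i\mathsf w_j=v^{\delta_{ij}}\mathsf w_j\mathsf D_i$. Local Lax matrices: $$L^{v,-1}_i(z)=\begin{pmatrix}\mathsf w_i^{-1}-\mathsf w_iz^{-1}&\mathsf w_i\mathsf D_i^{-1}\\-\mathsf w_i\mathsf D_iz^{-1}&\mathsf w_i\end{pmatrix},\quad L^{v,0}_i(z)=\begin{pmatrix}\mathsf w_i^{-1}z^{1/2}-\mathsf w_iz^{-1/2}&\mathsf D_i^{-1}z^{1/2}\\-\mathsf D_iz^{-1/2}&0\end{pmatrix},\quad L^{v,1}_i(z)=\begin{pmatrix}\mathsf w_i^{-1}z-\mathsf w_i&\mathsf w_i^{-1}\mathsf D_i^{-1}z\\-\mathsf w_i^{-1}\mathsf D_i&-\mathsf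 w_i^{-1}\end{pmatrix},$$ and $\mathsf T^v_{\vec k}(z)=L^{v,k_n}_n(z)\cdots L^{v,k_1}_1(z)$. *)

theory Defs
  imports
    "HOL-Analysis.Analysis"
    "HOL-Computational_Algebra.Computational_Algebra"
    "HOL-Library.Poly_Mapping"
begin

section \<open>The ground field\<close>

text \<open>
  With \<open>t = v\<^bsup>1/N\<^esup>\<close> the ground field is the field \<open>\<complex>(t)\<close> of rational functions, and
  \<open>v = t\<^sup>N\<close>. The positive integer \<open>N\<close> is the cardinality of a finite type \<open>'N\<close>.
\<close>

type_synonym ground = "complex poly fract"

definition v_param :: "'N::finite itself \<Rightarrow> ground" where
  "v_param _ = Fract [:0, 1:] 1 ^ CARD('N)"


section \<open>The algebra \<open>\<A>\<^sub>n\<close>\<close>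

text \<open>The number \<open>n\<close> is the cardinality of a finite type \<open>'n\<close>; indices run through \<open>1, \<dots>, n\<close>.\<close>

typedef 'n index = "{1..CARD('n::finite)}"
  by (auto intro!: exI[of _ 1] simp: Suc_le_eq)

datatype 'n gen = Gw "'n index" | Gw_inv "'n index" | GD "'n index" | GD_inv "'n index"

datatype 'n word = Word "'n gen list"

instantiation word :: (finite) monoid_add
begin

definition zero_word :: "'a word" where
  "0 = Word []"

fun plus_word :: "'a word \<Rightarrow> 'a word \<Rightarrow> 'a word" where
  "Word xs + Word ys = Word (xs @ ys)"

instance
proof
  fix a b c :: "'a word"
  show "a + b + c = a + (b + c)" by (cases a; cases b; cases c) simp
  show "0 + a = a" by (cases a) (simp add: zero_word_def)
  show "a + 0 = a" by (cases a) (simp add: zero_word_def)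
qed

end

text \<open>
  The free associative algebra is the monoid algebra of the free monoid of words; its
  multiplication is the convolution product of \<^theory>\<open>HOL-Library.Poly_Mapping\<close>.
\<close>

type_synonym 'n free_alg = "'n word \<Rightarrow>\<^sub>0 ground"

definition gen :: "'n::finite gen \<Rightarrow> 'n free_alg" where
  "gen g = Poly_Mapping.single (Word [g]) 1"

definition free_scalar :: "ground \<Rightarrow> 'n::finite free_alg" where
  "free_scalar c = Poly_Mapping.single 0 c"

text \<open>A relation \<open>x = y\<close> is recorded as the element \<open>x - y\<close>.\<close>

definition relators :: "'N::finite itself \<Rightarrow> 'n::finite free_alg set" where
  "relators N =
     (\<Union>i. {gen (Gw i) * gen (Gw_inv i) - 1, gen (Gw_inv i) * gen (Gw i) - 1,
            gen (GD i) * gen (GD_inv i) - 1, gen (GD_inv i) * gen (GD i) - 1}) \<union>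
     (\<Union>i j. {gen (Gw i) * gen (Gw j) - gen (Gw j) * gen (Gw i),
              gen (GD i) * gen (GD j) - gen (GD j) * gen (GD i),
              gen (GD i) * gen (Gw j)
                - free_scalar (if i = j then v_param N else 1) * (gen (Gw j) * gen (GD i))})"

definition two_sided_ideal :: "'a::ring_1 set \<Rightarrow> bool" where
  "two_sided_ideal I \<longleftrightarrow>
     0 \<in> I \<and> (\<forall>x\<in>I. \<forall>y\<in>I. x + y \<in> I) \<and> (\<forall>a. \<forall>x\<in>I. a * x \<in> I \<and> x * a \<in> I)"

definition rel_ideal :: "'N::finite itself \<Rightarrow> 'n::finite free_alg set" where
  "rel_ideal N = two_sided_ideal hull (relators N)"

definition rel_cong :: "'N::finite itself \<Rightarrow> 'n::finite free_alg \<Rightarrow> 'n free_alg \<Rightarrow> bool" where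
  "rel_cong N x y \<longleftrightarrow> x - y \<in> rel_ideal N"

lemma two_sided_ideal_rel_ideal: "two_sided_ideal (rel_ideal N)"
  unfolding rel_ideal_def by (rule hull_in) (auto simp: two_sided_ideal_def)

lemma rel_ideal_zero: "0 \<in> rel_ideal N"
  and rel_ideal_add: "x \<in> rel_ideal N \<Longrightarrow> y \<in> rel_ideal N \<Longrightarrow> x + y \<in> rel_ideal N"
  and rel_ideal_left: "x \<in> rel_ideal N \<Longrightarrow> a * x \<in> rel_ideal N"
  and rel_ideal_right: "x \<in> rel_ideal N \<Longrightarrow> x * a \<in> rel_ideal N"
  using two_sided_ideal_rel_ideal[of N] by (auto simp: two_sided_ideal_def)

lemma rel_ideal_uminus: "x \<in> rel_ideal N \<Longrightarrow> - x \<in> rel_ideal N"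
  using rel_ideal_left[of x N "- 1"] by simp

lemma equivp_rel_cong: "equivp (rel_cong N)"
proof (rule equivpI)
  show "reflp (rel_cong N)"
    by (simp add: reflp_def rel_cong_def rel_ideal_zero)
  show "symp (rel_cong N)"
    unfolding symp_def rel_cong_def using rel_ideal_uminus by fastforce
  show "transp (rel_cong N)"
    unfolding transp_def rel_cong_def using rel_ideal_add by fastforce
qed

text \<open>
  The remaining lemmas of this section show \<open>1 \<noteq> 0\<close> in \<open>\<A>\<^sub>n\<close>, as the class \<^class>\<open>ring_1\<close>
  demands, by letting the free algebra act on functions \<open>\<phi>\<close> on the lattice:
  \<open>w\<^sub>j\<close> acts as multiplication by \<open>v\<close> to the power \<open>x\<^sub>j\<close> and \<open>D\<^sub>j\<close> as the shift of \<open>x\<^sub>j\<close> by 1.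
\<close>

type_synonym 'n lattice_fun = "('n index \<Rightarrow> int) \<Rightarrow> ground"

fun gen_act :: "ground \<Rightarrow> 'n gen \<Rightarrow> 'n lattice_fun \<Rightarrow> 'n lattice_fun" where
  "gen_act q (Gw j) \<phi> = (\<lambda>x. q powi x j * \<phi> x)"
| "gen_act q (Gw_inv j) \<phi> = (\<lambda>x. q powi (- x j) * \<phi> x)"
| "gen_act q (GD j) \<phi> = (\<lambda>x. \<phi> (x(j := x j + 1)))"
| "gen_act q (GD_inv j) \<phi> = (\<lambda>x. \<phi> (x(j := x j - 1)))"

fun word_act :: "ground \<Rightarrow> 'n word \<Rightarrow> 'n lattice_fun \<Rightarrow> 'n lattice_fun" where
  "word_act q (Word gs) \<phi> = foldr (gen_act q) gs \<phi>"

definition act :: "ground \<Rightarrow> 'n::finite free_alg \<Rightarrow> 'n lattice_fun \<Rightarrow> 'n lattice_fun" where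
  "act q f \<phi> = (\<lambda>x. \<Sum>u\<in>Poly_Mapping.keys f. Poly_Mapping.lookup f u * word_act q u \<phi> x)"

lemma gen_act_add: "gen_act q g (\<lambda>x. \<phi> x + \<psi> x) = (\<lambda>x. gen_act q g \<phi> x + gen_act q g \<psi> x)"
  by (cases g) (auto simp: algebra_simps)

lemma gen_act_cmult: "gen_act q g (\<lambda>x. c * \<phi> x) = (\<lambda>x. c * gen_act q g \<phi> x)"
  by (cases g) (auto simp: algebra_simps)

lemma word_act_add:
  "word_act q u (\<lambda>x. \<phi> x + \<psi> x) = (\<lambda>x. word_act q u \<phi> x + word_act q u \<psi> x)"
proof (cases u)
  case (Word gs)
  have "foldr (gen_act q) gs (\<lambda>x. \<phi> x + \<psi> x)
      = (\<lambda>x. foldr (gen_act q) gs \<phi> x + foldr (gen_act q) gs \<psi> x)"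
    by (induction gs) (simp_all add: gen_act_add)
  with Word show ?thesis by simp
qed

lemma word_act_cmult: "word_act q u (\<lambda>x. c * \<phi> x) = (\<lambda>x. c * word_act q u \<phi> x)"
proof (cases u)
  case (Word gs)
  have "foldr (gen_act q) gs (\<lambda>x. c * \<phi> x) = (\<lambda>x. c * foldr (gen_act q) gs \<phi> x)"
    by (induction gs) (simp_all add: gen_act_cmult)
  with Word show ?thesis by simp
qed

lemma word_act_zero: "word_act q u (\<lambda>x. 0) = (\<lambda>x. 0)"
  using word_act_cmult[of q u 0 "\<lambda>x. 0"] by simp

lemma word_act_sum:
  "finite S \<Longrightarrow> word_act q u (\<lambda>x. \<Sum>s\<in>S. \<phi> s x) = (\<lambda>x. \<Sum>s\<in>S. word_act q u (\<phi> s) x)"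
  by (induction S rule: finite_induct) (simp_all add: word_act_zero word_act_add)

lemma word_act_plus: "word_act q (a + b) \<phi> = word_act q a (word_act q b \<phi>)"
  by (cases a; cases b) simp

lemma act_superset:
  assumes "finite S" "Poly_Mapping.keys f \<subseteq> S"
  shows "act q f \<phi> x = (\<Sum>u\<in>S. Poly_Mapping.lookup f u * word_act q u \<phi> x)"
  unfolding act_def by (rule sum.mono_neutral_left) (use assms in \<open>auto simp: in_keys_iff\<close>)

lemma act_zero: "act q 0 \<phi> = (\<lambda>x. 0)"
  by (simp add: act_def)

lemma act_add: "act q (f + g) \<phi> = (\<lambda>x. act q f \<phi> x + act q g \<phi> x)"
proof
  fix x
  let ?S = "Poly_Mapping.keys f \<union> Poly_Mapping.keys g"
  have "act q (f + g) \<phi> x = (\<Sum>u\<in>?S. Poly_Mapping.lookup (f + g) u * word_act q u \<phi> x)"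
    by (rule act_superset) (use Poly_Mapping.keys_add[of f g] in auto)
  also have "\<dots> = act q f \<phi> x + act q g \<phi> x"
    by (simp add: act_superset[of ?S f] act_superset[of ?S g] lookup_add distrib_right sum.distrib)
  finally show "act q (f + g) \<phi> x = act q f \<phi> x + act q g \<phi> x" .
qed

lemma act_sum: "finite S \<Longrightarrow> act q (\<Sum>s\<in>S. F s) \<phi> = (\<lambda>x. \<Sum>s\<in>S. act q (F s) \<phi> x)"
  by (induction S rule: finite_induct) (simp_all add: act_zero act_add)

lemma act_single: "act q (Poly_Mapping.single u c) \<phi> = (\<lambda>x. c * word_act q u \<phi> x)"
  by (auto simp: act_def)

lemma act_mult: "act q (f * g) \<phi> = act q f (act q g \<phi>)"
proof -
  let ?l = Poly_Mapping.lookup and ?k = Poly_Mapping.keys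
  have dec: "h = (\<Sum>u\<in>?k h. Poly_Mapping.single u (?l h u))" for h :: "'a free_alg"
    by (rule poly_mapping_eqI)
       (auto simp: lookup_sum lookup_single when_def in_keys_iff sum.delta')
  have "f * g = (\<Sum>a\<in>?k f. Poly_Mapping.single a (?l f a)) * (\<Sum>b\<in>?k g. Poly_Mapping.single b (?l g b))"
    using dec[of f] dec[of g] by simp
  also have "\<dots> = (\<Sum>a\<in>?k f. \<Sum>b\<in>?k g. Poly_Mapping.single (a + b) (?l f a * ?l g b))"
    by (simp add: sum_product mult_single)
  finally have "act q (f * g) \<phi>
      = (\<lambda>x. \<Sum>a\<in>?k f. \<Sum>b\<in>?k g. ?l f a * ?l g b * word_act q (a + b) \<phi> x)"
    by (simp add: act_sum act_single)
  also have "\<dots> = act q f (act q g \<phi>)"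
    by (simp add: act_def word_act_plus word_act_sum word_act_cmult sum_distrib_left mult.assoc)
  finally show ?thesis .
qed

lemma act_uminus: "act q (- f) \<phi> = (\<lambda>x. - act q f \<phi> x)"
  by (simp add: act_def sum_negf)

lemma act_diff: "act q (f - g) \<phi> = (\<lambda>x. act q f \<phi> x - act q g \<phi> x)"
  using act_add[of q f "- g" \<phi>] by (simp add: act_uminus)

lemma act_one: "act q 1 \<phi> = \<phi>"
  by (simp add: act_def lookup_one zero_word_def)

lemma act_gen: "act q (gen g) \<phi> = gen_act q g \<phi>"
  by (simp add: gen_def act_single)

lemma act_scalar: "act q (free_scalar c) \<phi> = (\<lambda>x. c * \<phi> x)"
  by (simp add: free_scalar_def act_single zero_word_def)

lemma v_nonzero: "v_param N \<noteq> 0"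
  by (simp add: v_param_def Fract_conv_to_fract)

lemma act_relator: "f \<in> relators N \<Longrightarrow> act (v_param N) f \<phi> = (\<lambda>x. 0)"
  unfolding relators_def
  by (auto simp del: right_minus_eq simp: act_zero act_diff act_mult act_one act_gen act_scalar v_nonzero fun_upd_twist
      power_int_minus power_int_add fun_eq_iff
      mult.assoc[symmetric] split: if_splits)

lemma one_notin_rel_ideal: "1 \<notin> (rel_ideal N :: 'n::finite free_alg set)"
proof
  let ?J = "{f :: 'n free_alg. \<forall>\<phi>. act (v_param N) f \<phi> = (\<lambda>x. 0)}"
  have "act (v_param N) a (\<lambda>x. 0) = (\<lambda>x. 0)" for a :: "'n free_alg"
    by (simp add: act_def word_act_zero)
  then have "two_sided_ideal ?J"
    by (simp add: two_sided_ideal_def act_zero act_add act_mult)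
  moreover have "relators N \<subseteq> ?J"
    using act_relator by blast
  ultimately have "rel_ideal N \<subseteq> ?J"
    unfolding rel_ideal_def by (intro hull_minimal)
  moreover assume "1 \<in> (rel_ideal N :: 'n free_alg set)"
  ultimately have "act (v_param N) (1 :: 'n free_alg) (\<lambda>x. 1) = (\<lambda>x. 0)"
    by blast
  then show False
    by (simp add: act_one fun_eq_iff)
qed

quotient_type (overloaded) ('N, 'n) qalg = "'n::finite free_alg" / "rel_cong TYPE('N::finite)"
  by (rule equivp_rel_cong)

instantiation qalg :: (finite, finite) ring_1
begin

lift_definition zero_qalg :: "('a, 'b) qalg" is 0 .
lift_definition one_qalg :: "('a, 'b) qalg" is 1 .

lift_definition plus_qalg :: "('a, 'b) qalg \<Rightarrow> ('a, 'b) qalg \<Rightarrow> ('a, 'b) qalg" is "(+)"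
  unfolding rel_cong_def using rel_ideal_add by (fastforce simp: algebra_simps)

lift_definition uminus_qalg :: "('a, 'b) qalg \<Rightarrow> ('a, 'b) qalg" is uminus
  unfolding rel_cong_def using rel_ideal_uminus by fastforce

lift_definition minus_qalg :: "('a, 'b) qalg \<Rightarrow> ('a, 'b) qalg \<Rightarrow> ('a, 'b) qalg" is "(-)"
proof -
  fix a b c d :: "'b free_alg"
  assume "rel_cong TYPE('a) a b" "rel_cong TYPE('a) c d"
  then have "(a - b) + - (c - d) \<in> rel_ideal TYPE('a)"
    unfolding rel_cong_def by (intro rel_ideal_add rel_ideal_uminus)
  then show "rel_cong TYPE('a) (a - c) (b - d)"
    unfolding rel_cong_def by (simp add: algebra_simps)
qed

lift_definition times_qalg :: "('a, 'b) qalg \<Rightarrow> ('a, 'b) qalg \<Rightarrow> ('a, 'b) qalg" is "(*)"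
proof -
  fix a b c d :: "'b free_alg"
  assume "rel_cong TYPE('a) a b" "rel_cong TYPE('a) c d"
  then have "(a - b) * c + b * (c - d) \<in> rel_ideal TYPE('a)"
    unfolding rel_cong_def by (intro rel_ideal_add rel_ideal_left rel_ideal_right)
  then show "rel_cong TYPE('a) (a * c) (b * d)"
    unfolding rel_cong_def by (simp add: algebra_simps)
qed

instance
proof
  fix a b c :: "('a, 'b) qalg"
  have refl: "rel_cong TYPE('a) x y" if "x = y" for x y :: "'b free_alg"
    using that by (simp add: rel_cong_def rel_ideal_zero)
  show "a + b + c = a + (b + c)" by transfer (rule refl, simp add: algebra_simps)
  show "a + b = b + a" by transfer (rule refl, simp add: algebra_simps)
  show "0 + a = a" by transfer (rule refl, simp)
  show "- a + a = 0" by transfer (rule refl, simp)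
  show "a - b = a + - b" by transfer (rule refl, simp)
  show "a * b * c = a * (b * c)" by transfer (rule refl, simp add: mult.assoc)
  show "1 * a = a" by transfer (rule refl, simp)
  show "a * 1 = a" by transfer (rule refl, simp)
  show "(a + b) * c = a * c + b * c" by transfer (rule refl, simp add: distrib_right)
  show "a * (b + c) = a * b + a * c" by transfer (rule refl, simp add: distrib_left)
  show "(0 :: ('a, 'b) qalg) \<noteq> 1"
  proof transfer
    show "\<not> rel_cong TYPE('a) (0 :: 'b free_alg) 1"
      using rel_ideal_uminus[of "- 1"] one_notin_rel_ideal by (auto simp: rel_cong_def)
  qed
qed

end

lift_definition scalar :: "ground \<Rightarrow> ('N::finite, 'n::finite) qalg" is free_scalar .

text \<open>The generators; they are meaningful only for \<open>1 \<le> j \<le> CARD('n)\<close>.\<close>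

lift_definition w_gen :: "nat \<Rightarrow> ('N::finite, 'n::finite) qalg" is "\<lambda>j. gen (Gw (Abs_index j))" .
lift_definition w_inv :: "nat \<Rightarrow> ('N::finite, 'n::finite) qalg" is "\<lambda>j. gen (Gw_inv (Abs_index j))" .
lift_definition D_gen :: "nat \<Rightarrow> ('N::finite, 'n::finite) qalg" is "\<lambda>j. gen (GD (Abs_index j))" .
lift_definition D_inv :: "nat \<Rightarrow> ('N::finite, 'n::finite) qalg" is "\<lambda>j. gen (GD_inv (Abs_index j))" .

definition w_pow :: "nat \<Rightarrow> int \<Rightarrow> ('N::finite, 'n::finite) qalg" where
  "w_pow j e = (if e \<ge> 0 then w_gen j ^ nat e else w_inv j ^ nat (- e))"

definition D_ratio :: "nat \<Rightarrow> nat \<Rightarrow> ('N::finite, 'n::finite) qalg" where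
  "D_ratio i j = D_gen i * D_inv j"

definition subalgebra :: "('N::finite, 'n::finite) qalg set \<Rightarrow> bool" where
  "subalgebra B \<longleftrightarrow>
     1 \<in> B \<and> (\<forall>x\<in>B. \<forall>y\<in>B. x + y \<in> B \<and> x * y \<in> B) \<and> (\<forall>c. \<forall>x\<in>B. scalar c * x \<in> B)"

definition generated_subalgebra :: "('N::finite, 'n::finite) qalg set \<Rightarrow> ('N, 'n) qalg set" where
  "generated_subalgebra S = subalgebra hull S"


section \<open>Lax and monodromy matrices\<close>

text \<open>
  Laurent polynomials in \<open>z\<^bsup>1/2\<^esup>\<close> with coefficients in \<open>\<A>\<^sub>n\<close>; the exponents of the central
  variable \<open>z\<close> are taken in \<open>\<rat>\<close>.
\<close>

type_synonym ('N, 'n) laurent = "rat \<Rightarrow>\<^sub>0 ('N, 'n) qalg"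

abbreviation zmon :: "('N::finite, 'n::finite) qalg \<Rightarrow> rat \<Rightarrow> ('N, 'n) laurent" where
  "zmon a e \<equiv> Poly_Mapping.single e a"

definition lax_m1 :: "nat \<Rightarrow> (('N::finite, 'n::finite) laurent)^2^2" where
  "lax_m1 i = vector
     [vector [zmon (w_inv i) 0 - zmon (w_gen i) (- 1), zmon (w_gen i * D_inv i) 0],
      vector [- zmon (w_gen i * D_gen i) (- 1), zmon (w_gen i) 0]]"

definition lax_0 :: "nat \<Rightarrow> (('N::finite, 'n::finite) laurent)^2^2" where
  "lax_0 i = vector
     [vector [zmon (w_inv i) (1/2) - zmon (w_gen i) (- (1/2)), zmon (D_inv i) (1/2)],
      vector [- zmon (D_gen i) (- (1/2)), 0]]"

definition lax_1 :: "nat \<Rightarrow> (('N::finite, 'n::finite) laurent)^2^2" where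
  "lax_1 i = vector
     [vector [zmon (w_inv i) 1 - zmon (w_gen i) 0, zmon (w_inv i * D_inv i) 1],
      vector [- zmon (w_inv i * D_gen i) 0, - zmon (w_inv i) 0]]"

definition lax :: "int \<Rightarrow> nat \<Rightarrow> (('N::finite, 'n::finite) laurent)^2^2" where
  "lax k i = (if k = - 1 then lax_m1 i else if k = 0 then lax_0 i else lax_1 i)"

primrec lax_prod :: "(nat \<Rightarrow> int) \<Rightarrow> nat \<Rightarrow> (('N::finite, 'n::finite) laurent)^2^2" where
  "lax_prod k 0 = mat 1"
| "lax_prod k (Suc m) = lax (k (Suc m)) (Suc m) ** lax_prod k m"

definition monodromy :: "(nat \<Rightarrow> int) \<Rightarrow> (('N::finite, 'n::finite) laurent)^2^2" where
  "monodromy k = lax_prod k CARD('n)"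

definition twisted_trace :: "ground \<Rightarrow> (nat \<Rightarrow> int) \<Rightarrow> ('N::finite, 'n::finite) laurent" where
  "twisted_trace \<epsilon> k = monodromy k $ 1 $ 1 + zmon (scalar \<epsilon>) 0 * monodromy k $ 2 $ 2"


section \<open>The first two Hamiltonians\<close>

text \<open>
  \<open>w_prod e i j\<close> is the product of \<open>w\<^sub>l\<close> to the power \<open>e l\<close> over \<open>i \<le> l \<le> j\<close>, taken in
  increasing order of \<open>l\<close> (the factors commute); it is \<open>1\<close> for \<open>i > j\<close>.
\<close>

definition w_prod :: "(nat \<Rightarrow> int) \<Rightarrow> nat \<Rightarrow> nat \<Rightarrow> ('N::finite, 'n::finite) qalg" where
  "w_prod e i j = prod_list (map (\<lambda>l. w_pow l (e l)) [i..<Suc j])"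

definition H1 :: "ground \<Rightarrow> (nat \<Rightarrow> int) \<Rightarrow> ('N::finite, 'n::finite) qalg" where
  "H1 \<epsilon> k =
     1 + scalar (\<epsilon> * (\<Prod>j=1..CARD('n). if k j = 1 then 1 else 0)) * w_prod (\<lambda>_. - 2) 1 CARD('n)"

definition H2 :: "ground \<Rightarrow> (nat \<Rightarrow> int) \<Rightarrow> ('N::finite, 'n::finite) qalg" where
  "H2 \<epsilon> k = (let n = CARD('n); e = (\<lambda>l. - k l - 1) in
     (\<Sum>j=1..n. w_pow j (- 2))
   + (\<Sum>i=1..<n. w_pow i (e i) * w_pow (i + 1) (e (i + 1)) * D_ratio i (i + 1))
   + (\<Sum>(i, j) \<in> {(i, j). 1 \<le> i \<and> i + 1 < j \<and> j \<le> n \<and> (\<forall>l\<in>{i<..<j}. k l = 1)}.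
        w_prod e i j * D_ratio i j)
   + scalar \<epsilon> *
      ((\<Sum>(i, j) \<in> {(i, j). 1 \<le> i \<and> i < j \<and> j \<le> n \<and>
                       (\<forall>l\<in>{1..<i}. k l = 1) \<and> (\<forall>l\<in>{j<..n}. k l = 1)}.
          w_prod e 1 i * w_prod e j n * D_ratio j i)
     + (\<Sum>j | 1 \<le> j \<and> j \<le> n \<and> k j = - 1 \<and> (\<forall>i\<in>{1..n}. i \<noteq> j \<longrightarrow> k i = 1).
          w_prod (\<lambda>_. - 2) 1 (j - 1) * w_prod (\<lambda>_. - 2) (j + 1) n)))"

end

theory Submission
  imports Defs
begin

text \<open>
  Up to the central factor \<open>z\<close> to the power \<open>(k - 1)/2\<close>, the three local Lax matrices are instances of a
  single matrix with entries \<open>w\<^sup>-\<^sup>1 z - w\<close>, \<open>f z\<close>, \<open>- e\<close>, \<open>\<alpha> w z - \<beta> w\<^sup>-\<^sup>1\<close>, where \<open>e = w\<^sup>-\<^sup>k D\<close> and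
  \<open>f = w\<^sup>-\<^sup>k D\<^sup>-\<^sup>1\<close>. The relation \<open>e f - f e = (v - v\<^sup>-\<^sup>1) (\<alpha> w\<^sup>2 - \<beta> w\<^sup>-\<^sup>2)\<close> is all that is needed for the
  RLL relation with the six-vertex R-matrix. It passes to products over the sites, and the twisted
  traces at two spectral parameters \<open>z\<close>, \<open>y\<close> commute because the R-matrix preserves weights; the two
  parameters are realised as Laurent polynomials with exponents in \<open>\<rat> \<times> \<rat>\<close>. Conjugating with
  \<open>diag(1, D\<^sub>1)\<close> leaves only ratios of the \<open>D\<^sub>i\<close>. Factoring \<open>- w\<close> out of each Lax matrix gives matrices
  polynomial in \<open>z\<close> and lower triangular at \<open>z = 0\<close>; expanding their product to first order in \<open>z\<close>
  gives the two Hamiltonians.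
\<close>

no_notation fps_nth (infixl "$" 75)

section \<open>The relations of the algebra\<close>

lemma qalg_eqI: "x - y \<in> rel_ideal TYPE('N::finite) \<Longrightarrow> rel_cong TYPE('N) x y"
  by (simp add: rel_cong_def)

lemma rel_cong_refl: "x = y \<Longrightarrow> rel_cong N x y"
  by (simp add: rel_cong_def rel_ideal_zero)

lemma relator_in_ideal: "r \<in> relators N \<Longrightarrow> r \<in> rel_ideal N"
  unfolding rel_ideal_def by (rule hull_inc)

lemma poly_mapping_sum_singles:
  "f = (\<Sum>a\<in>Poly_Mapping.keys f. Poly_Mapping.single a (Poly_Mapping.lookup f a))"
  by (rule poly_mapping_eqI)
     (auto simp: lookup_sum lookup_single when_def in_keys_iff sum.delta')

text \<open>Scalars sit on the empty word, the unit of the free monoid, so only coefficients change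
  places, and the ground field is commutative.\<close>

lemma free_scalar_commute: "free_scalar c * f = f * free_scalar c"
  by (subst (1 2) poly_mapping_sum_singles[of f])
     (simp add: free_scalar_def sum_distrib_left sum_distrib_right mult_single mult.commute)

lemma scalar_0 [simp]: "scalar 0 = 0"
  by transfer (simp add: rel_cong_refl free_scalar_def)

lemma scalar_1 [simp]: "scalar 1 = 1"
  by transfer (simp add: rel_cong_refl free_scalar_def)

lemma scalar_mult: "scalar (c * d) = scalar c * scalar d"
  by transfer (simp add: rel_cong_refl free_scalar_def mult_single)

lemma scalar_uminus: "scalar (- c) = - scalar c"
  by transfer (simp add: rel_cong_refl free_scalar_def single_uminus)

lemma scalar_commute: "scalar c * x = x * scalar c"
  by transfer (simp add: rel_cong_refl free_scalar_commute)

lemma w_gen_inv: "w_gen j * w_inv j = 1" and w_inv_gen: "w_inv j * w_gen j = 1"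
  and D_gen_inv: "D_gen j * D_inv j = 1" and D_inv_gen: "D_inv j * D_gen j = 1"
  by (transfer; rule qalg_eqI; rule relator_in_ideal; unfold relators_def; blast)+

lemma w_gen_commute: "w_gen i * w_gen j = w_gen j * w_gen i"
  and D_gen_commute: "D_gen i * D_gen j = D_gen j * D_gen i"
  by (transfer; rule qalg_eqI; rule relator_in_ideal; unfold relators_def; blast)+

text \<open>The case distinction compares values of \<open>Abs_index\<close>, which is injective
  only on \<open>{1..CARD('n)}\<close>; within that range it becomes \<open>i = j\<close>.\<close>

lemma D_w_gen:
  "D_gen i * w_gen j = scalar (if (Abs_index i :: 'n::finite index) = Abs_index j then v_param TYPE('N) else 1) *
     (w_gen j * D_gen i :: ('N::finite, 'n) qalg)"
  by transfer (rule qalg_eqI, rule relator_in_ideal, unfold relators_def, blast)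

lemma D_w_gen_same: "D_gen i * w_gen i = scalar (v_param TYPE('N)) * (w_gen i * D_gen i :: ('N::finite, 'n::finite) qalg)"
  by (simp add: D_w_gen)

lemma D_w_gen_distinct:
  assumes "i \<in> {1..CARD('n)}" "j \<in> {1..CARD('n)}" "i \<noteq> j"
  shows "D_gen i * w_gen j = (w_gen j * D_gen i :: ('N::finite, 'n::finite) qalg)"
  using assms by (simp add: D_w_gen Abs_index_inject)

section \<open>The RTT relation\<close>

text \<open>The tensor square of the rank-two module has the index type \<^typ>\<open>2 \<times> 2\<close>; the legs are \<open>T \<otimes> 1\<close> and \<open>1 \<otimes> T\<close>.\<close>

definition left_leg :: "'a::ring_1^2^2 \<Rightarrow> 'a^(2 \<times> 2)^(2 \<times> 2)" where
  "left_leg T = (\<chi> p q. if snd p = snd q then T $ fst p $ fst q else 0)"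

definition right_leg :: "'a::ring_1^2^2 \<Rightarrow> 'a^(2 \<times> 2)^(2 \<times> 2)" where
  "right_leg T = (\<chi> p q. if fst p = fst q then T $ snd p $ snd q else 0)"

text \<open>The trigonometric R-matrix with denominators cleared; \<open>vi\<close> stands for the
  inverse of \<open>v\<close>. The two off-diagonal weights carry \<open>z\<close> and
  \<open>y\<close> asymmetrically, the gauge that suits Lax matrices without half-integral powers of
  the spectral parameter.\<close>

definition six_vertex :: "'a::ring_1 \<Rightarrow> 'a \<Rightarrow> 'a \<Rightarrow> 'a \<Rightarrow> 'a^(2 \<times> 2)^(2 \<times> 2)" where
  "six_vertex v vi z y = (\<chi> p q.
     if p = q then (if fst p = snd p then v * z - vi * y else z - y)
     else if p = (1, 2) \<and> q = (2, 1) then (v - vi) * z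
     else if p = (2, 1) \<and> q = (1, 2) then (v - vi) * y else 0)"

text \<open>\<open>X\<close> and \<open>Y\<close> stand for one matrix evaluated at the spectral
  parameters \<open>z\<close> and \<open>y\<close>; as separate arguments they leave open how the
  evaluation is done.\<close>

definition rtt :: "'a::ring_1 \<Rightarrow> 'a \<Rightarrow> 'a \<Rightarrow> 'a \<Rightarrow> 'a^2^2 \<Rightarrow> 'a^2^2 \<Rightarrow> bool" where
  "rtt v vi z y X Y \<longleftrightarrow>
     six_vertex v vi z y ** left_leg X ** right_leg Y = right_leg Y ** left_leg X ** six_vertex v vi z y"

lemma sum_2x2: "sum f (UNIV :: (2 \<times> 2) set) = f (1, 1) + f (1, 2) + f (2, 1) + f (2, 2)"
  unfolding UNIV_Times_UNIV[symmetric] sum.cartesian_product' by (simp add: sum_2 add.assoc)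

lemma mat_2x2_eqI:
  assumes "\<And>i j p q. A $ (i, j) $ (p, q) = B $ (i, j) $ (p, q)"
  shows "(A :: 'a^(2 \<times> 2)^(2 \<times> 2)) = B"
  using assms by (simp add: vec_eq_iff)

lemma left_leg_mult: "left_leg (L ** T) = left_leg L ** left_leg T"
proof (rule mat_2x2_eqI)
  fix i j p q :: 2
  show "left_leg (L ** T) $ (i, j) $ (p, q) = (left_leg L ** left_leg T) $ (i, j) $ (p, q)"
    using exhaust_2[of i] exhaust_2[of j] exhaust_2[of p] exhaust_2[of q]
    by (auto simp: left_leg_def matrix_matrix_mult_def sum_2x2 sum_2)
qed

lemma right_leg_mult: "right_leg (L ** T) = right_leg L ** right_leg T"
proof (rule mat_2x2_eqI)
  fix i j p q :: 2
  show "right_leg (L ** T) $ (i, j) $ (p, q) = (right_leg L ** right_leg T) $ (i, j) $ (p, q)"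
    using exhaust_2[of i] exhaust_2[of j] exhaust_2[of p] exhaust_2[of q]
    by (auto simp: right_leg_def matrix_matrix_mult_def sum_2x2 sum_2)
qed

text \<open>The legs act on different tensor factors, so each entry of either product is a single
  product of one entry of \<open>T\<close> and one entry of \<open>L\<close>.\<close>

lemma leg_commute:
  assumes "\<And>i j p q. T $ i $ j * L $ p $ q = L $ p $ q * T $ i $ j"
  shows "left_leg T ** right_leg L = right_leg L ** left_leg T"
proof (rule mat_2x2_eqI)
  fix i j p q :: 2
  show "(left_leg T ** right_leg L) $ (i, j) $ (p, q) = (right_leg L ** left_leg T) $ (i, j) $ (p, q)"
    using exhaust_2[of i] exhaust_2[of j] exhaust_2[of p] exhaust_2[of q]
    by (auto simp: left_leg_def right_leg_def matrix_matrix_mult_def sum_2x2 assms)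
qed

text \<open>The usual train argument: the two inner legs have commuting entries and can be
  interchanged; then the R-matrix passes \<open>L\<close>, \<open>L'\<close> and next
  \<open>T\<close>, \<open>T'\<close>.\<close>

lemma rtt_mult:
  assumes "rtt v vi z y L L'" "rtt v vi z y T T'"
    and TL: "\<And>i j p q. T $ i $ j * L' $ p $ q = L' $ p $ q * T $ i $ j"
    and LT: "\<And>i j p q. L $ i $ j * T' $ p $ q = T' $ p $ q * L $ i $ j"
  shows "rtt v vi z y (L ** T) (L' ** T')"
proof -
  let ?R = "six_vertex v vi z y"
  have "?R ** left_leg (L ** T) ** right_leg (L' ** T')
      = ?R ** left_leg L ** (left_leg T ** right_leg L') ** right_leg T'"
    by (simp only: left_leg_mult right_leg_mult matrix_mul_assoc)
  also have "\<dots> = (?R ** left_leg L ** right_leg L') ** left_leg T ** right_leg T'"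
    by (simp only: leg_commute[OF TL] matrix_mul_assoc)
  also have "\<dots> = right_leg L' ** left_leg L ** (?R ** left_leg T ** right_leg T')"
    using assms(1) by (simp only: rtt_def matrix_mul_assoc)
  also have "\<dots> = right_leg L' ** (left_leg L ** right_leg T') ** left_leg T ** ?R"
    using assms(2) by (simp only: rtt_def matrix_mul_assoc)
  also have "\<dots> = right_leg (L' ** T') ** left_leg (L ** T) ** ?R"
    by (simp only: leg_commute[OF LT] left_leg_mult right_leg_mult matrix_mul_assoc)
  finally show ?thesis by (simp add: rtt_def)
qed

text \<open>\<open>v\<close>, \<open>z\<close> and \<open>y\<close> are elements of the same
  noncommutative ring as the matrix entries; centrality takes the place of a scalar action.\<close>

definition central :: "'a::ring_1 \<Rightarrow> bool" where
  "central c \<longleftrightarrow> (\<forall>x. x * c = c * x)"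

lemma centralD: "central c \<Longrightarrow> x * c = c * x"
  by (simp add: central_def)

lemma central_left: "central c \<Longrightarrow> x * (c * t) = c * (x * t)"
  by (metis centralD mult.assoc)

lemma rtt_mat_1:
  "rtt v vi z y (mat 1) (mat 1)"
proof -
  have "left_leg (mat 1 :: 'a^2^2) = mat 1" "right_leg (mat 1 :: 'a^2^2) = mat 1"
    by (auto simp: vec_eq_iff left_leg_def right_leg_def mat_def)
  then show ?thesis by (simp add: rtt_def)
qed

text \<open>\<open>wi\<close> plays the inverse of \<open>w\<close>. The coefficients \<alpha> and
  \<beta> will serve as switches, equal to 1 exactly for \<open>k = - 1\<close> and for
  \<open>k = 1\<close> respectively and to 0 otherwise.\<close>

definition gen_lax :: "'a::ring_1 \<Rightarrow> 'a \<Rightarrow> 'a \<Rightarrow> 'a \<Rightarrow> 'a \<Rightarrow> 'a \<Rightarrow> 'a \<Rightarrow> 'a^2^2" where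
  "gen_lax w wi e f \<alpha> \<beta> z = vector
     [vector [wi * z - w, f * z],
      vector [- e, \<alpha> * w * z - \<beta> * wi]]"

text \<open>Entrywise these are sixteen identities between words. Both sides are brought to a normal
  form with the central letters first, then \<open>f\<close>, then \<open>e\<close>, and finally
  powers of \<open>w\<close> and \<open>wi\<close>.\<close>

lemma gen_lax_rtt:
  fixes w wi e f \<alpha> \<beta> v vi z y :: "'a::ring_1"
  assumes cen: "central \<alpha>" "central \<beta>" "central v" "central vi" "central z" "central y"
    and vv: "v * vi = 1"
    and ww: "w * wi = 1" "wi * w = 1"
    and wf: "w * f = v * (f * w)" and we: "w * e = vi * (e * w)"
    and ef: "e * f = f * e + (v - vi) * (\<alpha> * (w * w) - \<beta> * (wi * wi))"
  shows "rtt v vi z y (gen_lax w wi e f \<alpha> \<beta> z) (gen_lax w wi e f \<alpha> \<beta> y)"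
proof -
  have vv': "vi * v = 1" using vv cen(3) by (simp add: centralD)
  \<comment> \<open>Conjugating the exchange relations of \<open>w\<close> by \<open>wi\<close>
    yields those of \<open>wi\<close>.\<close>
  have "wi * (w * f) * wi = wi * (v * (f * w)) * wi" by (simp add: wf)
  also have "\<dots> = v * (wi * f * (w * wi))"
    using cen(3) by (simp add: central_left mult.assoc)
  finally have "f * wi = v * (wi * f)"
    by (simp add: ww mult.assoc[symmetric])
  then have wif: "wi * f = vi * (f * wi)"
    by (simp add: mult.assoc[symmetric] vv')
  have "wi * (w * e) * wi = wi * (vi * (e * w)) * wi" by (simp add: we)
  also have "\<dots> = vi * (wi * e * (w * wi))"
    using cen(4) by (simp add: central_left mult.assoc)
  finally have "e * wi = vi * (wi * e)"
    by (simp add: ww mult.assoc[symmetric])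
  then have wie: "wi * e = v * (e * wi)"
    by (simp add: mult.assoc[symmetric] vv)
  \<comment> \<open>Closing each relation under multiplication on the right makes it applicable
    inside right-associated products.\<close>
  have assoc_rule: "a * b = c \<Longrightarrow> a * (b * t) = c * t" for a b c t :: 'a
    by (simp add: mult.assoc[symmetric])
  note rel = vv vv' ww wf we wif wie ef
  note rels = rel rel[THEN assoc_rule]
  \<comment> \<open>Central letters move left in the fixed order \<open>v\<close>,
    \<open>vi\<close>, \<alpha>, \<beta>, \<open>y\<close>, \<open>z\<close>. Listing the pairs one
    by one keeps two central letters from being swapped back and forth.\<close>
  note central_rules =
    centralD[OF cen(3), of f] central_left[OF cen(3), of f]
    centralD[OF cen(3), of e] central_left[OF cen(3), of e]
    centralD[OF cen(3), of w] central_left[OF cen(3), of w]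
    centralD[OF cen(3), of wi] central_left[OF cen(3), of wi]
    centralD[OF cen(3), of vi] central_left[OF cen(3), of vi]
    centralD[OF cen(3), of \<alpha>] central_left[OF cen(3), of \<alpha>]
    centralD[OF cen(3), of \<beta>] central_left[OF cen(3), of \<beta>]
    centralD[OF cen(3), of y] central_left[OF cen(3), of y]
    centralD[OF cen(3), of z] central_left[OF cen(3), of z]
    centralD[OF cen(4), of f] central_left[OF cen(4), of f]
    centralD[OF cen(4), of e] central_left[OF cen(4), of e]
    centralD[OF cen(4), of w] central_left[OF cen(4), of w]
    centralD[OF cen(4), of wi] central_left[OF cen(4), of wi]
    centralD[OF cen(4), of \<alpha>] central_left[OF cen(4), of \<alpha>]
    centralD[OF cen(4), of \<beta>] central_left[OF cen(4), of \<beta>]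
    centralD[OF cen(4), of y] central_left[OF cen(4), of y]
    centralD[OF cen(4), of z] central_left[OF cen(4), of z]
    centralD[OF cen(1), of f] central_left[OF cen(1), of f]
    centralD[OF cen(1), of e] central_left[OF cen(1), of e]
    centralD[OF cen(1), of w] central_left[OF cen(1), of w]
    centralD[OF cen(1), of wi] central_left[OF cen(1), of wi]
    centralD[OF cen(1), of \<beta>] central_left[OF cen(1), of \<beta>]
    centralD[OF cen(1), of y] central_left[OF cen(1), of y]
    centralD[OF cen(1), of z] central_left[OF cen(1), of z]
    centralD[OF cen(2), of f] central_left[OF cen(2), of f]
    centralD[OF cen(2), of e] central_left[OF cen(2), of e]
    centralD[OF cen(2), of w] central_left[OF cen(2), of w]
    centralD[OF cen(2), of wi] central_left[OF cen(2), of wi]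
    centralD[OF cen(2), of y] central_left[OF cen(2), of y]
    centralD[OF cen(2), of z] central_left[OF cen(2), of z]
    centralD[OF cen(6), of f] central_left[OF cen(6), of f]
    centralD[OF cen(6), of e] central_left[OF cen(6), of e]
    centralD[OF cen(6), of w] central_left[OF cen(6), of w]
    centralD[OF cen(6), of wi] central_left[OF cen(6), of wi]
    centralD[OF cen(6), of z] central_left[OF cen(6), of z]
    centralD[OF cen(5), of f] central_left[OF cen(5), of f]
    centralD[OF cen(5), of e] central_left[OF cen(5), of e]
    centralD[OF cen(5), of w] central_left[OF cen(5), of w]
    centralD[OF cen(5), of wi] central_left[OF cen(5), of wi]
  show ?thesis
    unfolding rtt_def
  proof (rule mat_2x2_eqI)
    fix i j p q :: 2
    let ?X = "gen_lax w wi e f \<alpha> \<beta> z" and ?Y = "gen_lax w wi e f \<alpha> \<beta> y"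
    show "(six_vertex v vi z y ** left_leg ?X ** right_leg ?Y) $ (i, j) $ (p, q)
        = (right_leg ?Y ** left_leg ?X ** six_vertex v vi z y) $ (i, j) $ (p, q)"
      using exhaust_2[of i] exhaust_2[of j] exhaust_2[of p] exhaust_2[of q]
      by (elim disjE; simp add: six_vertex_def left_leg_def right_leg_def gen_lax_def
            matrix_matrix_mult_def sum_2x2)
         (simp_all add: algebra_simps rels central_rules)
  qed
qed

section \<open>Commuting traces\<close>

text \<open>The R-matrix preserves weights: \<open>(1, 1)\<close> and \<open>(2, 2)\<close> span
  weight spaces of their own, which gives the first two relations, while the middle block couples
  \<open>(1, 2)\<close> with \<open>(2, 1)\<close> and brings in products of off-diagonal
  entries.\<close>

lemma rtt_entries:
  assumes "rtt v vi z y X Y"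
  shows "(v * z - vi * y) * X $ 1 $ 1 * Y $ 1 $ 1 = Y $ 1 $ 1 * X $ 1 $ 1 * (v * z - vi * y)"
    and "(v * z - vi * y) * X $ 2 $ 2 * Y $ 2 $ 2 = Y $ 2 $ 2 * X $ 2 $ 2 * (v * z - vi * y)"
    and "(z - y) * X $ 1 $ 1 * Y $ 2 $ 2 + (v - vi) * z * X $ 2 $ 1 * Y $ 1 $ 2
       = Y $ 2 $ 2 * X $ 1 $ 1 * (z - y) + Y $ 2 $ 1 * X $ 1 $ 2 * ((v - vi) * y)"
proof -
  note eq = assms[unfolded rtt_def, THEN arg_cong, of "\<lambda>M. M $ p $ q" for p q]
  note defs = six_vertex_def left_leg_def right_leg_def matrix_matrix_mult_def sum_2x2
  show "(v * z - vi * y) * X $ 1 $ 1 * Y $ 1 $ 1 = Y $ 1 $ 1 * X $ 1 $ 1 * (v * z - vi * y)"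
    using eq[of "(1, 1)" "(1, 1)"] by (simp add: defs)
  show "(v * z - vi * y) * X $ 2 $ 2 * Y $ 2 $ 2 = Y $ 2 $ 2 * X $ 2 $ 2 * (v * z - vi * y)"
    using eq[of "(2, 2)" "(2, 2)"] by (simp add: defs)
  show "(z - y) * X $ 1 $ 1 * Y $ 2 $ 2 + (v - vi) * z * X $ 2 $ 1 * Y $ 1 $ 2
       = Y $ 2 $ 2 * X $ 1 $ 1 * (z - y) + Y $ 2 $ 1 * X $ 1 $ 2 * ((v - vi) * y)"
    using eq[of "(1, 2)" "(1, 2)"] by (simp add: defs add.commute)
qed

section \<open>Coefficients and central elements of Laurent polynomial rings\<close>

lemma lookup_single_mult:
  fixes f :: "'k::ab_group_add \<Rightarrow>\<^sub>0 'b::semiring_0"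
  shows "Poly_Mapping.lookup (Poly_Mapping.single k c * f) x = c * Poly_Mapping.lookup f (x - k)"
proof -
  have "Poly_Mapping.single k c * f = (\<Sum>a\<in>Poly_Mapping.keys f. Poly_Mapping.single (k + a) (c * Poly_Mapping.lookup f a))"
    by (subst (1) poly_mapping_sum_singles[of f]) (simp add: sum_distrib_left mult_single)
  moreover have "k + a = x \<longleftrightarrow> a = x - k" for a
    by (auto simp: algebra_simps)
  ultimately have "Poly_Mapping.lookup (Poly_Mapping.single k c * f) x
      = (\<Sum>a\<in>Poly_Mapping.keys f. if a = x - k then c * Poly_Mapping.lookup f a else 0)"
    by (simp add: lookup_sum lookup_single when_def)
  then show ?thesis by (simp add: in_keys_iff)
qed

lemma central_single:
  fixes k :: "'k::ab_group_add" and c :: "'b::ring_1"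
  assumes "central c"
  shows "central (Poly_Mapping.single k c)"
  unfolding central_def
proof
  fix f :: "'k \<Rightarrow>\<^sub>0 'b"
  show "f * Poly_Mapping.single k c = Poly_Mapping.single k c * f"
    by (subst (1 2) poly_mapping_sum_singles[of f])
       (simp add: sum_distrib_left sum_distrib_right mult_single centralD[OF assms] add.commute)
qed

lemma central_1: "central 1"
  and central_scalar: "central (scalar c)"
  and central_of_bool: "central (of_bool P)"
  by (simp_all add: central_def scalar_commute)

lemma central_mult: "central c \<Longrightarrow> central d \<Longrightarrow> central (c * d)"
  by (metis central_def mult.assoc)

lemma central_diff: "central c \<Longrightarrow> central d \<Longrightarrow> central (c - d)"
  by (simp add: central_def algebra_simps)

text \<open>Pushforward along a map of exponents. For additive \<open>h\<close> it substitutes a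
  monomial for the variable, and this is how one Laurent polynomial gets evaluated at two
  independent spectral parameters.\<close>

definition push :: "('a \<Rightarrow> 'b) \<Rightarrow> ('a \<Rightarrow>\<^sub>0 'r) \<Rightarrow> ('b \<Rightarrow>\<^sub>0 'r::ring_1)" where
  "push h f = (\<Sum>a\<in>Poly_Mapping.keys f. Poly_Mapping.single (h a) (Poly_Mapping.lookup f a))"

lemma push_superset:
  assumes "finite S" "Poly_Mapping.keys f \<subseteq> S"
  shows "push h f = (\<Sum>a\<in>S. Poly_Mapping.single (h a) (Poly_Mapping.lookup f a))"
  unfolding push_def by (rule sum.mono_neutral_left) (use assms in \<open>auto simp: in_keys_iff\<close>)

lemma push_zero [simp]: "push h 0 = 0"
  by (simp add: push_def)

lemma push_single [simp]: "push h (Poly_Mapping.single a c) = Poly_Mapping.single (h a) c"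
  by (simp add: push_def)

lemma push_add: "push h (f + g) = push h f + push h g"
proof -
  let ?S = "Poly_Mapping.keys f \<union> Poly_Mapping.keys g"
  have "push h (f + g) = (\<Sum>a\<in>?S. Poly_Mapping.single (h a) (Poly_Mapping.lookup (f + g) a))"
    by (rule push_superset) (use Poly_Mapping.keys_add[of f g] in auto)
  also have "\<dots> = push h f + push h g"
    by (simp add: push_superset[of ?S f] push_superset[of ?S g] lookup_add single_add sum.distrib)
  finally show ?thesis .
qed

lemma push_uminus: "push h (- f) = - push h f"
  using push_add[of h f "- f"] by (simp add: eq_neg_iff_add_eq_0 add.commute)

lemma push_diff: "push h (f - g) = push h f - push h g"
  using push_add[of h f "- g"] by (simp add: push_uminus)

lemma push_sum: "push h (\<Sum>s\<in>S. F s) = (\<Sum>s\<in>S. push h (F s))"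
  by (induction S rule: infinite_finite_induct) (simp_all add: push_add)

lemma push_mult:
  assumes "\<And>a b. h (a + b) = h a + (h b :: 'b::monoid_add)"
  shows "push h (f * g) = push h f * push h g"
proof -
  have "f * g = (\<Sum>a\<in>Poly_Mapping.keys f. \<Sum>b\<in>Poly_Mapping.keys g.
      Poly_Mapping.single (a + b) (Poly_Mapping.lookup f a * Poly_Mapping.lookup g b))"
    by (subst (1) poly_mapping_sum_singles[of f], subst (1) poly_mapping_sum_singles[of g])
       (simp add: sum_product mult_single)
  then have "push h (f * g) = (\<Sum>a\<in>Poly_Mapping.keys f. \<Sum>b\<in>Poly_Mapping.keys g.
      Poly_Mapping.single (h a + h b) (Poly_Mapping.lookup f a * Poly_Mapping.lookup g b))"
    by (simp only: push_sum push_single assms)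
  then show ?thesis
    by (simp add: push_def sum_product mult_single)
qed

lemma push_matrix_mult:
  fixes A B :: "('a::monoid_add \<Rightarrow>\<^sub>0 'r::ring_1)^2^2"
  assumes "\<And>a b. h (a + b) = h a + (h b :: 'b::monoid_add)"
  shows "map_matrix (push h) (A ** B) = map_matrix (push h) A ** map_matrix (push h) B"
proof -
  have "push h (f * g) = push h f * push h g" for f g :: "'a \<Rightarrow>\<^sub>0 'r"
    by (rule push_mult) (rule assms)
  then show ?thesis
    by (simp add: vec_eq_iff map_matrix_def matrix_matrix_mult_def sum_2 push_add)
qed

lemma push_mat_1:
  assumes "h 0 = (0 :: 'b::monoid_add)"
  shows "map_matrix (push h) (mat 1 :: ('a::monoid_add \<Rightarrow>\<^sub>0 'r::ring_1)^2^2) = mat 1"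
proof -
  have "push h (1 :: 'a \<Rightarrow>\<^sub>0 'r) = 1"
    by (simp only: single_one[symmetric] push_single assms)
  then show ?thesis by (simp add: vec_eq_iff map_matrix_def mat_def)
qed

section \<open>Two independent spectral parameters\<close>

abbreviation fst_var :: "rat \<Rightarrow> rat \<times> rat" where "fst_var a \<equiv> (a, 0)"
abbreviation snd_var :: "rat \<Rightarrow> rat \<times> rat" where "snd_var a \<equiv> (0, a)"

text \<open>The exponent \<open>(a, b)\<close> determines the two exponents it comes from. Hence if
  the images of two polynomials in the two variables commute, every coefficient of one commutes with
  every coefficient of the other.\<close>

lemma lookup_push_fst_snd:
  "Poly_Mapping.lookup (push fst_var f * push snd_var g) (a, b) = Poly_Mapping.lookup f a * Poly_Mapping.lookup g b"
proof -
  have "Poly_Mapping.lookup (push fst_var f * push snd_var g) (a, b)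
     = (\<Sum>c\<in>Poly_Mapping.keys f. \<Sum>d\<in>Poly_Mapping.keys g.
          if c = a \<and> d = b then Poly_Mapping.lookup f c * Poly_Mapping.lookup g d else 0)"
    by (simp add: push_def sum_product mult_single lookup_sum lookup_single when_def)
  also have "\<dots> = (\<Sum>c\<in>Poly_Mapping.keys f. if c = a then \<Sum>d\<in>Poly_Mapping.keys g.
          if d = b then Poly_Mapping.lookup f c * Poly_Mapping.lookup g d else 0 else 0)"
    by (intro sum.cong refl) auto
  also have "\<dots> = Poly_Mapping.lookup f a * Poly_Mapping.lookup g b"
    by (simp add: in_keys_iff)
  finally show ?thesis .
qed

lemma lookup_push_snd_fst:
  "Poly_Mapping.lookup (push snd_var g * push fst_var f) (a, b) = Poly_Mapping.lookup g b * Poly_Mapping.lookup f a"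
proof -
  have "Poly_Mapping.lookup (push snd_var g * push fst_var f) (a, b)
     = (\<Sum>d\<in>Poly_Mapping.keys g. \<Sum>c\<in>Poly_Mapping.keys f.
          if c = a \<and> d = b then Poly_Mapping.lookup g d * Poly_Mapping.lookup f c else 0)"
    by (simp add: push_def sum_product mult_single lookup_sum lookup_single when_def)
  also have "\<dots> = (\<Sum>d\<in>Poly_Mapping.keys g. if d = b then \<Sum>c\<in>Poly_Mapping.keys f.
          if c = a then Poly_Mapping.lookup g d * Poly_Mapping.lookup f c else 0 else 0)"
    by (intro sum.cong refl) auto
  also have "\<dots> = Poly_Mapping.lookup g b * Poly_Mapping.lookup f a"
    by (simp add: in_keys_iff)
  finally show ?thesis .
qed

text \<open>Take a term of \<open>X\<close> with maximal exponent \<open>m\<close> in the first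
  variable. The first monomial sends it to exponent \<open>m + 1\<close>, where the second one,
  which leaves that exponent unchanged, contributes nothing to cancel it; and \<open>p\<close> has a
  left inverse.\<close>

lemma two_variable_cancel:
  fixes X :: "rat \<times> rat \<Rightarrow>\<^sub>0 'r::ring_1"
  assumes X: "(Poly_Mapping.single (1, 0) p - Poly_Mapping.single (0, 1) q) * X = 0" and p: "p' * p = 1"
  shows "X = 0"
proof (rule ccontr)
  assume "X \<noteq> 0"
  then have ne: "Poly_Mapping.keys X \<noteq> {}"
    by (metis poly_mapping_eqI in_keys_iff empty_iff lookup_zero)
  define m where "m = Max (fst ` Poly_Mapping.keys X)"
  have "m \<in> fst ` Poly_Mapping.keys X"
    unfolding m_def by (rule Max_in) (use ne in auto)
  then obtain b where b: "(m, b) \<in> Poly_Mapping.keys X" by auto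
  have "(m + 1, b - 1) \<notin> Poly_Mapping.keys X"
  proof
    assume "(m + 1, b - 1) \<in> Poly_Mapping.keys X"
    then have "m + 1 \<le> m" unfolding m_def by (intro Max_ge) (auto simp: image_iff intro: bexI[rotated])
    then show False by simp
  qed
  moreover have "p * Poly_Mapping.lookup X (m, b) - q * Poly_Mapping.lookup X (m + 1, b - 1) = 0"
    using arg_cong[OF X, of "\<lambda>f. Poly_Mapping.lookup f (m + 1, b)"]
    by (simp add: left_diff_distrib lookup_minus lookup_single_mult)
  ultimately have "p * Poly_Mapping.lookup X (m, b) = 0"
    by (simp add: in_keys_iff)
  then have "p' * p * Poly_Mapping.lookup X (m, b) = 0"
    by (simp add: mult.assoc)
  with p b show False by (simp add: in_keys_iff)
qed

section \<open>From the RTT relation to commuting coefficients\<close>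

lemma central_cancel_commute:
  fixes p :: "'a::ring_1"
  assumes "p * U * V = V * U * p" "central p" and cancel: "\<And>X. p * X = 0 \<Longrightarrow> X = 0"
  shows "U * V = V * U"
proof -
  have "p * (U * V - V * U) = 0"
    using assms(1) by (simp add: right_diff_distrib centralD[OF assms(2)] mult.assoc)
  then show ?thesis using cancel by fastforce
qed

text \<open>
  The off-diagonal contributions to the commutator of \<open>X\<^sub>1\<^sub>1\<close> and \<open>Y\<^sub>2\<^sub>2\<close> are antisymmetric under
  the exchange of the spectral parameters, and so is \<open>z - y\<close>: the commutator is symmetric.
\<close>

lemma rtt_imp_trace_commute:
  fixes X Y :: "'a::ring_1^2^2"
  assumes rtt: "rtt v vi z y X Y" "rtt v vi y z Y X"
    and cen: "central v" "central vi" "central z" "central y" "central t"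
    and cancel_a: "\<And>U. (v * z - vi * y) * U = 0 \<Longrightarrow> U = 0"
    and cancel_b: "\<And>U. (z - y) * U = 0 \<Longrightarrow> U = 0"
  shows "(X $ 1 $ 1 + t * X $ 2 $ 2) * (Y $ 1 $ 1 + t * Y $ 2 $ 2)
       = (Y $ 1 $ 1 + t * Y $ 2 $ 2) * (X $ 1 $ 1 + t * X $ 2 $ 2)"
proof -
  define p where "p = z - y"
  define r where "r = (v - vi) * y"
  define s where "s = (v - vi) * z"
  have cen': "central (v * z - vi * y)" "central p" "central r" "central s"
    unfolding p_def r_def s_def by (intro central_mult central_diff cen)+
  note E = rtt_entries[OF rtt(1), folded p_def r_def s_def]
  \<comment> \<open>Exchanging the parameters negates the weight \<open>p\<close> and swaps
    \<open>r\<close> with \<open>s\<close>.\<close>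
  have yz: "y - z = - p" by (simp add: p_def)
  note E4 = rtt_entries(3)[OF rtt(2), unfolded yz, folded r_def s_def]
  have A: "X $ 1 $ 1 * Y $ 1 $ 1 = Y $ 1 $ 1 * X $ 1 $ 1"
    by (rule central_cancel_commute[OF rtt_entries(1)[OF rtt(1)] cen'(1) cancel_a])
  have D: "X $ 2 $ 2 * Y $ 2 $ 2 = Y $ 2 $ 2 * X $ 2 $ 2"
    by (rule central_cancel_commute[OF rtt_entries(2)[OF rtt(1)] cen'(1) cancel_a])
  have "p * (X $ 1 $ 1 * Y $ 2 $ 2 - Y $ 2 $ 2 * X $ 1 $ 1)
      = r * (Y $ 2 $ 1 * X $ 1 $ 2) - s * (X $ 2 $ 1 * Y $ 1 $ 2)"
    using E(3) centralD[OF cen'(2), of "Y $ 2 $ 2 * X $ 1 $ 1"] centralD[OF cen'(3), of "Y $ 2 $ 1 * X $ 1 $ 2"]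
    by (simp add: algebra_simps)
  moreover have "p * (Y $ 1 $ 1 * X $ 2 $ 2 - X $ 2 $ 2 * Y $ 1 $ 1)
      = r * (Y $ 2 $ 1 * X $ 1 $ 2) - s * (X $ 2 $ 1 * Y $ 1 $ 2)"
    using E4 centralD[OF cen'(2), of "X $ 2 $ 2 * Y $ 1 $ 1"] centralD[OF cen'(4), of "X $ 2 $ 1 * Y $ 1 $ 2"]
    by (simp add: algebra_simps)
  ultimately have "p * ((X $ 1 $ 1 * Y $ 2 $ 2 - Y $ 2 $ 2 * X $ 1 $ 1)
      - (Y $ 1 $ 1 * X $ 2 $ 2 - X $ 2 $ 2 * Y $ 1 $ 1)) = 0"
    by (simp add: right_diff_distrib)
  then have "(X $ 1 $ 1 * Y $ 2 $ 2 - Y $ 2 $ 2 * X $ 1 $ 1)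
      - (Y $ 1 $ 1 * X $ 2 $ 2 - X $ 2 $ 2 * Y $ 1 $ 1) = 0"
    unfolding p_def by (rule cancel_b)
  \<comment> \<open>The mixed terms are matched only as a sum; together with \<open>A\<close> and
    \<open>D\<close> this suffices for the twisted trace.\<close>
  then have "X $ 1 $ 1 * Y $ 2 $ 2 + X $ 2 $ 2 * Y $ 1 $ 1 = Y $ 1 $ 1 * X $ 2 $ 2 + Y $ 2 $ 2 * X $ 1 $ 1"
    by (simp add: algebra_simps)
  then have "t * (X $ 1 $ 1 * Y $ 2 $ 2) + t * (X $ 2 $ 2 * Y $ 1 $ 1)
      = t * (Y $ 1 $ 1 * X $ 2 $ 2) + t * (Y $ 2 $ 2 * X $ 1 $ 1)"
    by (simp add: distrib_left[symmetric])
  then show ?thesis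
    by (simp add: distrib_left distrib_right mult.assoc A D
          central_left[OF cen(5), of "X $ i $ i" for i] central_left[OF cen(5), of "Y $ i $ i" for i])
       (simp add: add_ac)
qed

text \<open>Both assignments of the two variables occur in the hypothesis, since the trace argument
  also uses the relation with the spectral parameters exchanged.\<close>

lemma rtt_imp_lookup_commute:
  fixes T :: "('N::finite, 'n::finite) laurent^2^2" and \<epsilon> :: ground
  assumes "v \<noteq> 0"
    and "\<And>h1 h2 :: rat \<Rightarrow> rat \<times> rat. (h1 = fst_var \<and> h2 = snd_var) \<or> (h1 = snd_var \<and> h2 = fst_var) \<Longrightarrow>
      rtt (Poly_Mapping.single 0 (scalar v)) (Poly_Mapping.single 0 (scalar (inverse v)))
        (Poly_Mapping.single (h1 1) 1) (Poly_Mapping.single (h2 1) 1)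
        (map_matrix (push h1) T) (map_matrix (push h2) T)"
  defines "t \<equiv> T $ 1 $ 1 + zmon (scalar \<epsilon>) 0 * T $ 2 $ 2"
  shows "Poly_Mapping.lookup t a * Poly_Mapping.lookup t b = Poly_Mapping.lookup t b * Poly_Mapping.lookup t a"
proof -
  have t: "push h t = map_matrix (push h) T $ 1 $ 1 + Poly_Mapping.single 0 (scalar \<epsilon>) * map_matrix (push h) T $ 2 $ 2"
    if "h = fst_var \<or> h = snd_var" for h
    using that by (auto simp: t_def push_add push_mult map_matrix_def zero_prod_def)
  have "push fst_var t * push snd_var t = push snd_var t * push fst_var t"
    unfolding t[OF disjI1[OF refl]] t[OF disjI2[OF refl]]
  proof (rule rtt_imp_trace_commute[OF assms(2) assms(2)])
    fix U :: "rat \<times> rat \<Rightarrow>\<^sub>0 ('N, 'n) qalg"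
    show "U = 0" if "(Poly_Mapping.single 0 (scalar v) * Poly_Mapping.single (1, 0) 1
        - Poly_Mapping.single 0 (scalar (inverse v)) * Poly_Mapping.single (0, 1) 1) * U = 0"
      using that assms(1)
      \<comment> \<open>The coefficient of the first variable is \<open>scalar v\<close>, which is
        invertible because \<open>v\<close> is nonzero.\<close>
      by (intro two_variable_cancel[of "scalar v" "scalar (inverse v)" U "scalar (inverse v)"])
         (simp_all add: mult_single scalar_mult[symmetric])
    show "U = 0" if "(Poly_Mapping.single (1, 0) 1 - Poly_Mapping.single (0, 1) 1) * U = 0"
      using that by (intro two_variable_cancel[of 1 1 U 1]) simp_all
  qed (simp_all add: central_single central_1 central_scalar)
  then have "Poly_Mapping.lookup (push fst_var t * push snd_var t) (a, b)
      = Poly_Mapping.lookup (push snd_var t * push fst_var t) (a, b)"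
    by simp
  then show ?thesis by (simp only: lookup_push_fst_snd lookup_push_snd_fst)
qed

section \<open>The RTT relation for the monodromy matrix\<close>

lemma commute_inverse:
  assumes "x * u = u * x" "u * u' = 1" "u' * u = (1 :: 'a::monoid_mult)"
  shows "x * u' = u' * x"
proof -
  have "x * u' = u' * (u * x) * u'"
    by (simp add: assms(3) flip: mult.assoc)
  also have "\<dots> = u' * x * (u * u')"
    by (simp only: assms(1)[symmetric] mult.assoc)
  finally show ?thesis by (simp add: assms(2))
qed

lemma w_inv_commute: "w_gen i * w_inv j = w_inv j * w_gen i" "w_inv i * w_inv j = w_inv j * w_inv i"
proof -
  show *: "w_gen i * w_inv j = w_inv j * w_gen i" for i j
    by (rule commute_inverse[OF w_gen_commute w_gen_inv w_inv_gen])
  show "w_inv i * w_inv j = w_inv j * w_inv i"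
    by (rule commute_inverse[OF *[symmetric] w_gen_inv w_inv_gen])
qed

lemma D_inv_commute: "D_gen i * D_inv j = D_inv j * D_gen i" "D_inv i * D_inv j = D_inv j * D_inv i"
proof -
  show *: "D_gen i * D_inv j = D_inv j * D_gen i" for i j
    by (rule commute_inverse[OF D_gen_commute D_gen_inv D_inv_gen])
  show "D_inv i * D_inv j = D_inv j * D_inv i"
    by (rule commute_inverse[OF *[symmetric] D_gen_inv D_inv_gen])
qed

text \<open>Ultralocality of the Lax matrices is the commutation of these sets for different
  sites.\<close>

definition site_gens :: "nat \<Rightarrow> ('N::finite, 'n::finite) qalg set" where
  "site_gens j = {w_gen j, w_inv j, D_gen j, D_inv j}"

lemma D_w_commute:
  assumes "i \<in> {1..CARD('n)}" "j \<in> {1..CARD('n)}" "i \<noteq> j"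
    and "x \<in> {D_gen i, D_inv i}" "y \<in> {w_gen j, w_inv j}"
  shows "x * y = y * (x :: ('N::finite, 'n::finite) qalg)"
proof -
  have "y * D_gen i = D_gen i * y"
    using assms(5) commute_inverse[OF D_w_gen_distinct[OF assms(1-3), where 'N = 'N] w_gen_inv w_inv_gen]
      D_w_gen_distinct[OF assms(1-3), where 'N = 'N] by auto
  then show ?thesis
    using assms(4) commute_inverse[OF _ D_gen_inv D_inv_gen, of y i] by auto
qed

lemma site_gens_commute:
  fixes x y :: "('N::finite, 'n::finite) qalg"
  assumes "i \<in> {1..CARD('n)}" "j \<in> {1..CARD('n)}" "i \<noteq> j" "x \<in> site_gens i" "y \<in> site_gens j"
  shows "x * y = y * x"
proof -
  consider "x \<in> {w_gen i, w_inv i}" "y \<in> {w_gen j, w_inv j}" | "x \<in> {D_gen i, D_inv i}" "y \<in> {D_gen j, D_inv j}"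
    | "x \<in> {D_gen i, D_inv i}" "y \<in> {w_gen j, w_inv j}" | "x \<in> {w_gen i, w_inv i}" "y \<in> {D_gen j, D_inv j}"
    using assms(4,5) by (auto simp: site_gens_def)
  then show ?thesis
  proof cases
    case 1
    then show ?thesis
      by (auto simp: w_gen_commute w_inv_commute)
  next
    case 2
    then show ?thesis
      by (auto simp: D_gen_commute D_inv_commute)
  next
    case 3
    then show ?thesis using D_w_commute assms by blast
  next
    case 4
    then show ?thesis using D_w_commute[of j i y x] assms by simp
  qed
qed

text \<open>Conjugating the exchange relation of \<open>D_gen i\<close> and \<open>w_gen i\<close>
  by \<open>D_inv i\<close> inverts the scalar. The next two relations arise in the same way,
  conjugating by \<open>w_inv i\<close>.\<close>

lemma D_inv_w_gen: "D_inv i * w_gen i = scalar (inverse (v_param TYPE('N))) * (w_gen i * D_inv i :: ('N::finite, 'n::finite) qalg)"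
proof -
  let ?v = "v_param TYPE('N)"
  have "D_inv i * (D_gen i * w_gen i) * D_inv i = scalar ?v * (D_inv i * w_gen i * (D_gen i * D_inv i :: ('N, 'n) qalg))"
    by (simp only: D_w_gen_same scalar_commute[of ?v] mult.assoc)
  then have "w_gen i * D_inv i = scalar ?v * (D_inv i * w_gen i :: ('N, 'n) qalg)"
    by (simp add: D_gen_inv) (simp add: D_inv_gen flip: mult.assoc)
  then have "scalar (inverse ?v) * (w_gen i * D_inv i) = scalar (inverse ?v * ?v) * (D_inv i * w_gen i :: ('N, 'n) qalg)"
    by (simp add: scalar_mult mult.assoc)
  then show ?thesis by (simp add: v_nonzero)
qed

lemma D_gen_w_inv: "D_gen i * w_inv i = scalar (inverse (v_param TYPE('N))) * (w_inv i * D_gen i :: ('N::finite, 'n::finite) qalg)"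
proof -
  let ?v = "v_param TYPE('N)"
  have "w_inv i * (D_gen i * w_gen i) * w_inv i = scalar ?v * (w_inv i * w_gen i * (D_gen i * w_inv i) :: ('N, 'n) qalg)"
    by (simp only: D_w_gen_same scalar_commute[of ?v] mult.assoc)
  then have "w_inv i * D_gen i = scalar ?v * (D_gen i * w_inv i :: ('N, 'n) qalg)"
    by (simp add: w_gen_inv w_inv_gen mult.assoc)
  then have "scalar (inverse ?v) * (w_inv i * D_gen i) = scalar (inverse ?v * ?v) * (D_gen i * w_inv i :: ('N, 'n) qalg)"
    by (simp add: scalar_mult mult.assoc)
  then show ?thesis by (simp add: v_nonzero)
qed

lemma D_inv_w_inv: "D_inv i * w_inv i = scalar (v_param TYPE('N)) * (w_inv i * D_inv i :: ('N::finite, 'n::finite) qalg)"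
proof -
  let ?v = "inverse (v_param TYPE('N))"
  have "w_inv i * (D_inv i * w_gen i) * w_inv i = scalar ?v * (w_inv i * w_gen i * (D_inv i * w_inv i) :: ('N, 'n) qalg)"
    by (simp only: D_inv_w_gen scalar_commute[of ?v] mult.assoc)
  then have "w_inv i * D_inv i = scalar ?v * (D_inv i * w_inv i :: ('N, 'n) qalg)"
    by (simp add: w_gen_inv w_inv_gen mult.assoc)
  then have "scalar (inverse ?v) * (w_inv i * D_inv i) = scalar (inverse ?v * ?v) * (D_inv i * w_inv i :: ('N, 'n) qalg)"
    by (simp only: scalar_mult mult.assoc)
  then show ?thesis by (simp add: v_nonzero)
qed

text \<open>\<open>lax k i\<close> without its factor \<open>z\<close> to the power \<open>(k - 1)/2\<close>, so that no half-integral powers remain.\<close>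

definition shifted_lax :: "int \<Rightarrow> nat \<Rightarrow> (('N::finite, 'n::finite) laurent)^2^2" where
  "shifted_lax k i = vector
     [vector [zmon (w_inv i) 1 - zmon (w_gen i) 0, zmon (w_pow i (- k) * D_inv i) 1],
      vector [- zmon (w_pow i (- k) * D_gen i) 0,
              zmon (if k = - 1 then w_gen i else 0) 1 - zmon (if k = 1 then w_inv i else 0) 0]]"

primrec shifted_lax_prod :: "(nat \<Rightarrow> int) \<Rightarrow> nat \<Rightarrow> (('N::finite, 'n::finite) laurent)^2^2" where
  "shifted_lax_prod k 0 = mat 1"
| "shifted_lax_prod k (Suc m) = shifted_lax (k (Suc m)) (Suc m) ** shifted_lax_prod k m"

lemma lax_eq_shifted_lax:
  assumes "k \<in> {- 1, 0, 1}"
  shows "lax k i $ a $ b = zmon 1 ((of_int k - 1) / 2) * shifted_lax k i $ a $ b"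
  using assms exhaust_2[of a] exhaust_2[of b]
  by (auto simp: lax_def lax_m1_def lax_0_def lax_1_def shifted_lax_def w_pow_def mult_single right_diff_distrib)

text \<open>Powers of \<open>z\<close> are central, so the prefactors of all sites gather into
  one.\<close>

lemma lax_prod_eq_shifted_lax_prod:
  assumes "\<And>j. j \<in> {1..m} \<Longrightarrow> k j \<in> {- 1, 0, 1}"
  shows "lax_prod k m $ a $ b = zmon 1 (\<Sum>j=1..m. (of_int (k j) - 1) / 2) * shifted_lax_prod k m $ a $ b"
  using assms
proof (induction m arbitrary: a b)
  case 0
  then show ?case by simp
next
  case (Suc m)
  have c: "x * zmon 1 s = zmon 1 s * x" "x * (zmon 1 s * y) = zmon 1 s * (x * y)" for x y :: "('a, 'b) laurent" and s
    by (rule centralD central_left; rule central_single; rule central_1)+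
  have "zmon 1 ((of_int (k (Suc m)) - 1) / 2) * x * (zmon 1 s * y)
      = zmon 1 (s + (of_int (k (Suc m)) - 1) / 2) * (x * y)" for x y :: "('a, 'b) laurent" and s
    by (simp only: mult.assoc c(2)[of x]) (simp add: mult_single flip: mult.assoc, simp add: add.commute)
  with Suc show ?case
    by (simp add: matrix_matrix_mult_def sum_2 lax_eq_shifted_lax distrib_left)
qed

lemma shifted_lax_gen_lax:
  fixes i :: nat and h :: "rat \<Rightarrow> rat \<times> rat"
  assumes "h 0 = 0"
  shows "map_matrix (push h) (shifted_lax k i :: (('N::finite, 'n::finite) laurent)^2^2)
    = gen_lax (Poly_Mapping.single 0 (w_gen i)) (Poly_Mapping.single 0 (w_inv i))
        (Poly_Mapping.single 0 (w_pow i (- k) * D_gen i)) (Poly_Mapping.single 0 (w_pow i (- k) * D_inv i))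
        (of_bool (k = - 1)) (of_bool (k = 1)) (Poly_Mapping.single (h 1) 1)"
  by (simp add: vec_eq_iff forall_2 map_matrix_def shifted_lax_def gen_lax_def push_diff push_uminus assms mult_single)

lemma shifted_lax_rtt:
  fixes h1 h2 :: "rat \<Rightarrow> rat \<times> rat" and v :: ground
  assumes "k \<in> {- 1, 0, 1}" "h1 0 = 0" "h2 0 = 0"
  defines "v \<equiv> v_param TYPE('N)"
  shows "rtt (Poly_Mapping.single 0 (scalar v)) (Poly_Mapping.single 0 (scalar (inverse v)))
        (Poly_Mapping.single (h1 1) 1) (Poly_Mapping.single (h2 1) 1)
        (map_matrix (push h1) (shifted_lax k i :: (('N::finite, 'n::finite) laurent)^2^2)) (map_matrix (push h2) (shifted_lax k i))"
proof -
  let ?w = "w_gen i :: ('N, 'n) qalg" and ?wi = "w_inv i :: ('N, 'n) qalg"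
  let ?D = "D_gen i :: ('N, 'n) qalg" and ?Di = "D_inv i :: ('N, 'n) qalg"
  let ?v = "scalar v :: ('N, 'n) qalg" and ?vi = "scalar (inverse v) :: ('N, 'n) qalg"
  have assoc_rule: "a * b = c \<Longrightarrow> a * (b * t) = c * t" for a b c t :: "('N, 'n) qalg"
    by (simp add: mult.assoc[symmetric])
  have vv: "?v * ?vi = 1" "?vi * ?v = 1"
    by (simp_all add: v_def v_nonzero flip: scalar_mult)
  have rel: "?D * ?w = ?v * (?w * ?D)" "?D * ?wi = ?vi * (?wi * ?D)"
    "?Di * ?w = ?vi * (?w * ?Di)" "?Di * ?wi = ?v * (?wi * ?Di)"
    by (simp_all add: v_def D_w_gen_same D_gen_w_inv D_inv_w_gen D_inv_w_inv)
  note basic = vv rel w_gen_inv[of i] w_inv_gen[of i] D_gen_inv[of i] D_inv_gen[of i]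
  have sc: "x * scalar c = scalar c * x" "x * (scalar c * y) = scalar c * (x * y)"
    for x y :: "('N, 'n) qalg" and c
    by (rule centralD[OF central_scalar], rule central_left[OF central_scalar])
  \<comment> \<open>Scalars are moved only past the four letters of the site, never past each
    other.\<close>
  note rules = basic basic[THEN assoc_rule] sc[of ?w] sc[of ?wi] sc[of ?D] sc[of ?Di]
  let ?e = "w_pow i (- k) * ?D" and ?f = "w_pow i (- k) * ?Di"
  have we: "?w * ?e = ?vi * (?e * ?w)" and wf: "?w * ?f = ?v * (?f * ?w)"
    using assms(1) by (auto simp: w_pow_def mult.assoc rules)
  \<comment> \<open>For \<open>k = - 1\<close> the two products are \<open>?v\<close> and
    \<open>?vi\<close> times the square of \<open>?w\<close>; for \<open>k = 1\<close> they are
    \<open>?vi\<close> and \<open>?v\<close> times the square of \<open>?wi\<close>; for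
    \<open>k = 0\<close> both are 1.\<close>
  have ef: "?e * ?f = ?f * ?e + (?v - ?vi) * (of_bool (k = - 1) * (?w * ?w) - of_bool (k = 1) * (?wi * ?wi))"
    using assms(1) by (auto simp: w_pow_def mult.assoc rules algebra_simps)
  show ?thesis
    unfolding shifted_lax_gen_lax[of h1, OF assms(2)] shifted_lax_gen_lax[of h2, OF assms(3)]
  proof (rule gen_lax_rtt)
    show "Poly_Mapping.single 0 ?e * Poly_Mapping.single 0 ?f =
      Poly_Mapping.single (0 :: rat \<times> rat) ?f * Poly_Mapping.single 0 ?e +
      (Poly_Mapping.single 0 ?v - Poly_Mapping.single 0 ?vi) *
      (of_bool (k = - 1) * (Poly_Mapping.single 0 ?w * Poly_Mapping.single 0 ?w) -
       of_bool (k = 1) * (Poly_Mapping.single 0 ?wi * Poly_Mapping.single 0 ?wi))"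
      using ef assms(1) by (auto simp: mult_single simp flip: single_add single_diff single_uminus)
  qed (auto simp: central_single central_1 central_scalar central_of_bool mult_single vv we wf w_gen_inv w_inv_gen)
qed

section \<open>Commutation of Lax matrices across sites\<close>

lemma lookup_mult_single_0:
  fixes f :: "'k::ab_group_add \<Rightarrow>\<^sub>0 'b::semiring_0"
  shows "Poly_Mapping.lookup (f * Poly_Mapping.single 0 c) x = Poly_Mapping.lookup f x * c"
proof -
  have "f * Poly_Mapping.single 0 c = (\<Sum>a\<in>Poly_Mapping.keys f. Poly_Mapping.single a (Poly_Mapping.lookup f a * c))"
    by (subst (1) poly_mapping_sum_singles[of f]) (simp add: sum_distrib_right mult_single)
  then show ?thesis by (simp add: lookup_sum lookup_single when_def in_keys_iff)
qed

text \<open>This trades commutation with a matrix entry for commutation with its coefficients, and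
  back.\<close>

lemma zmon_commute_iff:
  "zmon x 0 * f = f * zmon x 0 \<longleftrightarrow> (\<forall>a. x * Poly_Mapping.lookup f a = Poly_Mapping.lookup f a * x)"
  by (simp add: poly_mapping_eq_iff fun_eq_iff lookup_single_mult lookup_mult_single_0)

lemma push_commute:
  assumes "\<And>a b. Poly_Mapping.lookup f a * Poly_Mapping.lookup g b = Poly_Mapping.lookup g b * Poly_Mapping.lookup f a"
  shows "push h1 f * push h2 g = push h2 g * (push h1 f :: 'k::ab_group_add \<Rightarrow>\<^sub>0 'r::ring_1)"
  unfolding push_def sum_product
  by (subst sum.swap) (simp add: mult_single assms add.commute)

lemma commute_add: "x * a = a * x \<Longrightarrow> x * b = b * x \<Longrightarrow> x * (a + b) = (a + b) * (x :: 'a::ring)"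
  by (simp add: distrib_left distrib_right)

lemma commute_mult: "x * a = a * x \<Longrightarrow> x * b = b * x \<Longrightarrow> x * (a * b) = (a * b) * (x :: 'a::semigroup_mult)"
  by (metis mult.assoc)

lemma commute_power: "x * a = a * x \<Longrightarrow> x * a ^ n = a ^ n * (x :: 'a::monoid_mult)"
  by (simp add: power_commuting_commutes)

lemma w_pow_commute:
  "x * w_gen i = w_gen i * x \<Longrightarrow> x * w_inv i = w_inv i * x \<Longrightarrow> x * w_pow i e = w_pow i e * x"
  by (simp add: w_pow_def commute_power)

lemma shifted_lax_commute:
  assumes "\<And>y. y \<in> site_gens i \<Longrightarrow> x * y = y * x"
  shows "zmon x 0 * shifted_lax k i $ a $ b = shifted_lax k i $ a $ b * zmon x 0"
proof -
  have [simp]: "x * w_gen i = w_gen i * x" "x * w_inv i = w_inv i * x" "x * D_gen i = D_gen i * x" "x * D_inv i = D_inv i * x"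
    using assms by (auto simp: site_gens_def)
  note [simp] = w_pow_commute commute_mult
  show ?thesis
    using exhaust_2[of a] exhaust_2[of b]
    by (auto simp: shifted_lax_def right_diff_distrib left_diff_distrib mult_single)
qed

lemma shifted_lax_prod_commute:
  assumes "\<And>i y. i \<in> {1..m} \<Longrightarrow> y \<in> site_gens i \<Longrightarrow> x * y = y * x"
  shows "zmon x 0 * shifted_lax_prod k m $ a $ b = shifted_lax_prod k m $ a $ b * zmon x 0"
  using assms
proof (induction m arbitrary: a b)
  case 0
  show ?case by (simp add: mat_def)
next
  case (Suc m)
  have "zmon x 0 * shifted_lax (k (Suc m)) (Suc m) $ a $ c = shifted_lax (k (Suc m)) (Suc m) $ a $ c * zmon x 0" for a c
    by (rule shifted_lax_commute, rule Suc.prems[of "Suc m"], auto)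
  moreover have "zmon x 0 * shifted_lax_prod k m $ c $ b = shifted_lax_prod k m $ c $ b * zmon x 0" for c b
    by (rule Suc.IH, rule Suc.prems, auto)
  ultimately show ?case
    by (simp add: matrix_matrix_mult_def sum_2 commute_add commute_mult)
qed

text \<open>Locality is used in two rounds: the generators of the new site commute with every
  coefficient of the product over earlier sites, and each such coefficient then commutes with the
  Lax matrix of the new site.\<close>

lemma shifted_lax_prod_shifted_lax_commute:
  fixes k :: "nat \<Rightarrow> int"
  assumes "m < CARD('n::finite)"
  shows "push h1 (shifted_lax_prod k m $ a $ b) * push h2 (shifted_lax l (Suc m) $ c $ d)
    = push h2 (shifted_lax l (Suc m) $ c $ d) * (push h1 (shifted_lax_prod k m $ a $ b) :: rat \<times> rat \<Rightarrow>\<^sub>0 ('N::finite, 'n) qalg)"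
proof (rule push_commute)
  fix p q
  let ?x = "Poly_Mapping.lookup (shifted_lax_prod k m $ a $ b :: ('N, 'n) laurent) p"
  have "y * ?x = ?x * y" if "y \<in> site_gens (Suc m)" for y
  proof -
    have "zmon y 0 * shifted_lax_prod k m $ a $ b = shifted_lax_prod k m $ a $ b * zmon y 0"
      by (rule shifted_lax_prod_commute, rule site_gens_commute[OF _ _ _ that]) (use assms in auto)
    then show ?thesis by (simp add: zmon_commute_iff)
  qed
  then have "zmon ?x 0 * shifted_lax l (Suc m) $ c $ d = shifted_lax l (Suc m) $ c $ d * zmon ?x 0"
    by (intro shifted_lax_commute) simp
  then show "?x * Poly_Mapping.lookup (shifted_lax l (Suc m) $ c $ d) q = Poly_Mapping.lookup (shifted_lax l (Suc m) $ c $ d) q * ?x"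
    by (simp add: zmon_commute_iff)
qed

lemma shifted_lax_prod_rtt:
  fixes h1 h2 :: "rat \<Rightarrow> rat \<times> rat"
  assumes "\<And>j. j \<in> {1..m} \<Longrightarrow> k j \<in> {- 1, 0, 1}" "m \<le> CARD('n::finite)"
    and h: "h1 0 = 0" "h2 0 = 0" "\<And>a b. h1 (a + b) = h1 a + h1 b" "\<And>a b. h2 (a + b) = h2 a + h2 b"
  shows "rtt (Poly_Mapping.single 0 (scalar (v_param TYPE('N)))) (Poly_Mapping.single 0 (scalar (inverse (v_param TYPE('N)))))
        (Poly_Mapping.single (h1 1) 1) (Poly_Mapping.single (h2 1) 1)
        (map_matrix (push h1) (shifted_lax_prod k m :: (('N::finite, 'n) laurent)^2^2)) (map_matrix (push h2) (shifted_lax_prod k m))"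
  using assms(1,2)
proof (induction m)
  case 0
  show ?case
    unfolding shifted_lax_prod.simps push_mat_1[of h1, OF h(1)] push_mat_1[of h2, OF h(2)]
    by (rule rtt_mat_1)
next
  case (Suc m)
  show ?case
    unfolding shifted_lax_prod.simps push_matrix_mult[of h1, OF h(3)] push_matrix_mult[of h2, OF h(4)]
  proof (rule rtt_mult)
    show "rtt (Poly_Mapping.single 0 (scalar (v_param TYPE('N)))) (Poly_Mapping.single 0 (scalar (inverse (v_param TYPE('N)))))
        (Poly_Mapping.single (h1 1) 1) (Poly_Mapping.single (h2 1) 1)
        (map_matrix (push h1) (shifted_lax (k (Suc m)) (Suc m) :: (('N::finite, 'n) laurent)^2^2))
        (map_matrix (push h2) (shifted_lax (k (Suc m)) (Suc m)))"
      by (rule shifted_lax_rtt) (use Suc.prems h in auto)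
  qed (use Suc in \<open>simp_all add: map_matrix_def shifted_lax_prod_shifted_lax_commute\<close>)
qed

section \<open>The subalgebra of ratios\<close>

declare One_nat_def [simp del]

section \<open>Generated subalgebras and centralizers\<close>

lemma subalgebra_generated: "subalgebra (generated_subalgebra S)"
  unfolding generated_subalgebra_def by (rule hull_in) (auto simp: subalgebra_def)

lemma generated_subalgebra_inc: "x \<in> S \<Longrightarrow> x \<in> generated_subalgebra S"
  unfolding generated_subalgebra_def by (rule hull_inc)

lemma generated_subalgebra_minimal: "S \<subseteq> B \<Longrightarrow> subalgebra B \<Longrightarrow> generated_subalgebra S \<subseteq> B"
  unfolding generated_subalgebra_def by (rule hull_minimal)

lemma subalgebra_centralizer: "subalgebra {x. \<forall>y\<in>Y. x * y = y * x}"
  unfolding subalgebra_def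
proof (intro conjI ballI allI CollectI)
  fix x x' y c
  assume x: "x \<in> {x. \<forall>y\<in>Y. x * y = y * x}" and x': "x' \<in> {x. \<forall>y\<in>Y. x * y = y * x}" and "y \<in> Y"
  then have "y * x = x * y" "y * x' = x' * y" by auto
  then show "(x + x') * y = y * (x + x')" "x * x' * y = y * (x * x')"
    by (simp_all add: commute_add commute_mult)
next
  fix x y c
  assume "x \<in> {x. \<forall>y\<in>Y. x * y = y * x}" "y \<in> Y"
  then have "y * x = x * y" by simp
  then show "scalar c * x * y = y * (scalar c * x)"
    by (simp add: commute_mult scalar_commute)
qed simp

text \<open>Centralizers are subalgebras. As \<open>S\<close> lies in its own centralizer, so does
  the subalgebra it generates; thus \<open>S\<close> centralizes that subalgebra, and taking the
  hull once more gives the claim.\<close>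

lemma generated_subalgebra_commute:
  assumes "\<And>x y. x \<in> S \<Longrightarrow> y \<in> S \<Longrightarrow> x * y = y * x"
    and "x \<in> generated_subalgebra S" "y \<in> generated_subalgebra S"
  shows "x * y = y * x"
proof -
  have "generated_subalgebra S \<subseteq> {x. \<forall>y\<in>S. x * y = y * x}"
    using assms(1) by (intro generated_subalgebra_minimal subalgebra_centralizer) auto
  then have "S \<subseteq> {x. \<forall>y\<in>generated_subalgebra S. x * y = y * x}"
    by (force simp: subset_iff)
  then have "generated_subalgebra S \<subseteq> {x. \<forall>y\<in>generated_subalgebra S. x * y = y * x}"
    by (intro generated_subalgebra_minimal subalgebra_centralizer)
  with assms show ?thesis by blast
qed

section \<open>Commuting coefficients of the twisted trace\<close>

lemma twisted_trace_shifted_lax_prod: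
  fixes k :: "nat \<Rightarrow> int" and \<epsilon> :: ground
  assumes "\<And>j. j \<in> {1..CARD('n)} \<Longrightarrow> k j \<in> {- 1, 0, 1}"
  shows "(twisted_trace \<epsilon> k :: ('N::finite, 'n::finite) laurent) = zmon 1 (\<Sum>j=1..CARD('n). (of_int (k j) - 1) / 2) *
     (shifted_lax_prod k CARD('n) $ 1 $ 1 + zmon (scalar \<epsilon>) 0 * shifted_lax_prod k CARD('n) $ 2 $ 2)"
proof -
  have "lax_prod k CARD('n) $ a $ b = zmon 1 (\<Sum>j=1..CARD('n). (of_int (k j) - 1) / 2) * (shifted_lax_prod k CARD('n) $ a $ b :: ('N, 'n) laurent)" for a b
    by (rule lax_prod_eq_shifted_lax_prod, erule assms)
  then show ?thesis
    unfolding twisted_trace_def monodromy_def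
    by (simp add: distrib_left central_left[OF central_single[OF central_1], of "zmon (scalar \<epsilon>) 0"])
qed

text \<open>A power of \<open>z\<close> in front only shifts exponents, so passing to integral
  powers does not change the set of coefficients.\<close>

lemma lookup_shift_range:
  fixes f :: "'k::ab_group_add \<Rightarrow>\<^sub>0 'b::semiring_1"
  shows "range (Poly_Mapping.lookup (Poly_Mapping.single s 1 * f)) = range (Poly_Mapping.lookup f)"
proof -
  have "Poly_Mapping.lookup (Poly_Mapping.single s 1 * f) = Poly_Mapping.lookup f \<circ> (\<lambda>x. x - s)"
    by (simp add: fun_eq_iff lookup_single_mult)
  moreover have "surj (\<lambda>x. x - s)"
    by (rule surjI[of _ "\<lambda>x. x + s"]) simp
  ultimately show ?thesis by (simp only: image_comp[symmetric])
qed

lemma twisted_trace_coeffs_commute: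
  fixes k :: "nat \<Rightarrow> int" and \<epsilon> :: ground
  assumes "\<And>j. j \<in> {1..CARD('n)} \<Longrightarrow> k j \<in> {- 1, 0, 1}"
  defines "T \<equiv> twisted_trace \<epsilon> k :: ('N::finite, 'n::finite) laurent"
  assumes "x \<in> range (Poly_Mapping.lookup T)" "y \<in> range (Poly_Mapping.lookup T)"
  shows "x * y = y * x"
proof -
  let ?S = "shifted_lax_prod k CARD('n) :: (('N, 'n) laurent)^2^2"
  let ?t = "?S $ 1 $ 1 + zmon (scalar \<epsilon>) 0 * ?S $ 2 $ 2"
  have "Poly_Mapping.lookup ?t a * Poly_Mapping.lookup ?t b = Poly_Mapping.lookup ?t b * Poly_Mapping.lookup ?t a" for a b
  proof (rule rtt_imp_lookup_commute[of "v_param TYPE('N)"])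
    fix h1 h2 :: "rat \<Rightarrow> rat \<times> rat"
    assume "h1 = fst_var \<and> h2 = snd_var \<or> h1 = snd_var \<and> h2 = fst_var"
    then show "rtt (Poly_Mapping.single 0 (scalar (v_param TYPE('N)))) (Poly_Mapping.single 0 (scalar (inverse (v_param TYPE('N)))))
        (Poly_Mapping.single (h1 1) 1) (Poly_Mapping.single (h2 1) 1) (map_matrix (push h1) ?S) (map_matrix (push h2) ?S)"
      using assms(1) by (intro shifted_lax_prod_rtt) (auto simp: zero_prod_def)
  qed (rule v_nonzero)
  moreover have "range (Poly_Mapping.lookup T) = range (Poly_Mapping.lookup ?t)"
    unfolding T_def by (subst twisted_trace_shifted_lax_prod, erule assms(1), rule lookup_shift_range)
  ultimately show ?thesis using assms(3,4) by auto
qed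

section \<open>Laurent polynomials over a subalgebra\<close>

definition coeffs_in :: "'r set \<Rightarrow> ('k \<Rightarrow>\<^sub>0 'r::ring_1) \<Rightarrow> bool" where
  "coeffs_in B f \<longleftrightarrow> (\<forall>a. Poly_Mapping.lookup f a \<in> B)"

context
  fixes B :: "('N::finite, 'n::finite) qalg set"
  assumes B: "subalgebra B"
begin

lemma subalgebra_mult: "x \<in> B \<Longrightarrow> y \<in> B \<Longrightarrow> x * y \<in> B"
  and subalgebra_add: "x \<in> B \<Longrightarrow> y \<in> B \<Longrightarrow> x + y \<in> B"
  and subalgebra_scalar_mult: "x \<in> B \<Longrightarrow> scalar c * x \<in> B"
  and subalgebra_1: "1 \<in> B"
  using B by (auto simp: subalgebra_def)

lemma subalgebra_scalar: "scalar c \<in> B"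
  using subalgebra_scalar_mult[OF subalgebra_1, of c] by simp

lemma subalgebra_0: "0 \<in> B"
  using subalgebra_scalar[of 0] by simp

lemma subalgebra_uminus: "x \<in> B \<Longrightarrow> - x \<in> B"
  using subalgebra_scalar_mult[of x "- 1"] by (simp add: scalar_uminus)

lemma subalgebra_power: "x \<in> B \<Longrightarrow> x ^ n \<in> B"
  by (induction n) (simp_all add: subalgebra_1 subalgebra_mult)

lemma subalgebra_sum: "(\<And>s. s \<in> S \<Longrightarrow> F s \<in> B) \<Longrightarrow> sum F S \<in> B"
  by (induction S rule: infinite_finite_induct) (simp_all add: subalgebra_0 subalgebra_add)

lemma coeffs_in_add: "coeffs_in B f \<Longrightarrow> coeffs_in B g \<Longrightarrow> coeffs_in B (f + g)"
  by (simp add: coeffs_in_def lookup_add subalgebra_add)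

lemma coeffs_in_uminus: "coeffs_in B f \<Longrightarrow> coeffs_in B (- f)"
  by (simp add: coeffs_in_def subalgebra_uminus)

lemma coeffs_in_diff: "coeffs_in B f \<Longrightarrow> coeffs_in B g \<Longrightarrow> coeffs_in B (f - g)"
  using coeffs_in_add[of f "- g"] coeffs_in_uminus[of g] by simp

lemma coeffs_in_single: "x \<in> B \<Longrightarrow> coeffs_in B (Poly_Mapping.single a x)"
  by (simp add: coeffs_in_def lookup_single when_def subalgebra_0)

lemma coeffs_in_mult:
  fixes f g :: "'k::monoid_add \<Rightarrow>\<^sub>0 ('N, 'n) qalg"
  assumes "coeffs_in B f" "coeffs_in B g"
  shows "coeffs_in B (f * g)"
proof -
  have "f * g = (\<Sum>a\<in>Poly_Mapping.keys f. \<Sum>b\<in>Poly_Mapping.keys g.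
      Poly_Mapping.single (a + b) (Poly_Mapping.lookup f a * Poly_Mapping.lookup g b))"
    by (subst (1) poly_mapping_sum_singles[of f], subst (1) poly_mapping_sum_singles[of g])
       (simp add: sum_product mult_single)
  then show ?thesis
    using assms
    by (auto simp: coeffs_in_def lookup_sum lookup_single when_def
          intro!: subalgebra_sum subalgebra_mult subalgebra_0)
qed

end

section \<open>The algebra of ratios and the gauge transformation\<close>

definition ratio_gens :: "('N::finite, 'n::finite) qalg set" where
  "ratio_gens = w_gen ` {1..CARD('n)} \<union> w_inv ` {1..CARD('n)} \<union>
     (\<Union>i\<in>{1..<CARD('n)}. {D_ratio i (i + 1), D_ratio (i + 1) i})"

abbreviation ratio_alg :: "('N::finite, 'n::finite) qalg set" where
  "ratio_alg \<equiv> generated_subalgebra ratio_gens"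

lemma D_ratio_mult: "D_ratio i j * D_ratio j l = D_ratio i l"
proof -
  have "D_ratio i j * D_ratio j l = D_gen i * (D_inv j * D_gen j) * D_inv l"
    by (simp only: D_ratio_def mult.assoc)
  then show ?thesis by (simp add: D_inv_gen D_ratio_def)
qed

text \<open>Neighbouring ratios telescope. Site 1 is the reference because the gauge transformation
  uses \<open>D_gen 1\<close>.\<close>

lemma D_ratio_in_ratio_alg:
  assumes "j \<in> {1..CARD('n)}"
  shows "D_ratio 1 j \<in> (ratio_alg :: ('N::finite, 'n::finite) qalg set)"
    and "D_ratio j 1 \<in> (ratio_alg :: ('N, 'n) qalg set)"
proof -
  note B = subalgebra_generated[of "ratio_gens :: ('N, 'n) qalg set"]
  have "j \<ge> 1" using assms by simp
  then have "j \<le> CARD('n) \<longrightarrow> D_ratio 1 j \<in> (ratio_alg :: ('N, 'n) qalg set) \<and> D_ratio j 1 \<in> (ratio_alg :: ('N, 'n) qalg set)"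
  proof (induction j rule: dec_induct)
    case base
    show ?case by (simp add: D_ratio_def D_gen_inv subalgebra_1[OF subalgebra_generated])
  next
    case (step j)
    show ?case
    proof
      assume le: "Suc j \<le> CARD('n)"
      have "j \<in> {1..<CARD('n)}" using step.hyps le by simp
      then have "{D_ratio j (j + 1), D_ratio (j + 1) j} \<subseteq> (ratio_gens :: ('N, 'n) qalg set)"
        unfolding ratio_gens_def by blast
      then have "D_ratio j (Suc j) \<in> (ratio_gens :: ('N, 'n) qalg set)" "D_ratio (Suc j) j \<in> (ratio_gens :: ('N, 'n) qalg set)"
        by (simp_all add: Suc_eq_plus1)
      then show "D_ratio 1 (Suc j) \<in> (ratio_alg :: ('N, 'n) qalg set) \<and> D_ratio (Suc j) 1 \<in> (ratio_alg :: ('N, 'n) qalg set)"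
        using step le
          subalgebra_mult[OF B generated_subalgebra_inc, of "D_ratio (Suc j) j" "D_ratio j 1"]
          subalgebra_mult[OF B _ generated_subalgebra_inc, of "D_ratio 1 j" "D_ratio j (Suc j)"]
        by (simp add: D_ratio_mult)
    qed
  qed
  then show "D_ratio 1 j \<in> (ratio_alg :: ('N::finite, 'n::finite) qalg set)"
    and "D_ratio j 1 \<in> (ratio_alg :: ('N, 'n) qalg set)"
    using assms by auto
qed

lemma w_in_ratio_alg:
  assumes "j \<in> {1..CARD('n)}"
  shows "w_gen j \<in> (ratio_alg :: ('N::finite, 'n::finite) qalg set)" "w_inv j \<in> (ratio_alg :: ('N, 'n) qalg set)"
    "w_pow j e \<in> (ratio_alg :: ('N, 'n) qalg set)"
proof -
  show *: "w_gen j \<in> (ratio_alg :: ('N::finite, 'n::finite) qalg set)" "w_inv j \<in> (ratio_alg :: ('N, 'n) qalg set)"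
    using assms by (auto intro!: generated_subalgebra_inc simp: ratio_gens_def)
  show "w_pow j e \<in> (ratio_alg :: ('N, 'n) qalg set)"
    by (simp add: w_pow_def subalgebra_power[OF subalgebra_generated] *)
qed

text \<open>Conjugation by \<open>D_gen 1\<close> is an automorphism that rescales
  \<open>w_gen 1\<close> and \<open>w_inv 1\<close> and fixes the other generators; hence the
  elements it sends into the algebra form a subalgebra containing all generators.\<close>

lemma ratio_alg_conj:
  fixes x d d' :: "('N::finite, 'n::finite) qalg"
  assumes "x \<in> ratio_alg" and d: "(d, d') = (D_gen 1, D_inv 1) \<or> (d, d') = (D_inv 1, D_gen 1)"
  shows "d * x * d' \<in> ratio_alg"
proof -
  let ?C = "{x :: ('N, 'n) qalg. d * x * d' \<in> ratio_alg}"
  note B = subalgebra_generated[of "ratio_gens :: ('N, 'n) qalg set"]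
  have dd: "d * d' = 1" "d' * d = 1"
    using d by (auto simp: D_gen_inv D_inv_gen)
  have "subalgebra ?C"
    unfolding subalgebra_def
  proof (intro conjI ballI allI)
    fix x y c assume xy: "x \<in> ?C" "y \<in> ?C"
    have "d * (x * y) * d' = (d * x * d') * (d * y * d')"
      by (simp add: mult.assoc) (simp add: dd flip: mult.assoc)
    with xy show "x * y \<in> ?C" by (simp add: subalgebra_mult[OF B])
    from xy show "x + y \<in> ?C" by (simp add: distrib_left distrib_right subalgebra_add[OF B])
  next
    fix x c assume "x \<in> ?C"
    moreover have "d * (scalar c * x) * d' = scalar c * (d * x * d')"
      by (simp only: mult.assoc central_left[OF central_scalar, of d])
    ultimately show "scalar c * x \<in> ?C" by (simp add: subalgebra_scalar_mult[OF B])
  qed (simp add: dd subalgebra_1[OF B])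
  moreover have "ratio_gens \<subseteq> ?C"
  proof
    fix x :: "('N, 'n) qalg" assume x: "x \<in> ratio_gens"
    then have "x \<in> ratio_alg" by (rule generated_subalgebra_inc)
    moreover have "(\<exists>j\<in>{1..CARD('n)}. x = w_gen j \<or> x = w_inv j) \<or> (\<exists>i j. x = D_ratio i j)"
      using x unfolding ratio_gens_def by auto
    ultimately consider (w) j where "j \<in> {1..CARD('n)}" "x = w_gen j \<or> x = w_inv j"
      | (D) i j where "x = D_ratio i j" "x \<in> ratio_alg"
      by blast
    then show "x \<in> ?C"
    proof cases
      case w
      have "\<exists>c. d * x = scalar c * (x * d)"
      proof (cases "j = 1")
        case True
        then show ?thesis
          using w(2) d
          by (elim disjE; simp only: prod.inject)
             (rule exI, rule D_w_gen_same D_inv_w_gen D_gen_w_inv D_inv_w_inv)+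
      next
        case False
        then have "d * x = x * d"
          using w d D_w_commute[of 1 j d x] by auto
        then show ?thesis by (intro exI[of _ 1]) simp
      qed
      then obtain c where "d * x = scalar c * (x * d)" ..
      then have "d * x * d' = scalar c * x"
        by (simp add: mult.assoc dd)
      moreover have "x \<in> ratio_alg" using w(2) w_in_ratio_alg[OF w(1), where 'N = 'N] by auto
      ultimately show ?thesis by (simp add: subalgebra_scalar_mult[OF B])
    next
      case D
      have "d * x = x * d"
        unfolding D(1) D_ratio_def
        by (rule commute_mult) (use d in \<open>auto simp: D_gen_commute D_inv_commute\<close>)
      then have "d * x * d' = x" by (simp add: mult.assoc dd)
      with D show ?thesis by simp
    qed
  qed
  ultimately have "ratio_alg \<subseteq> ?C"
    by (intro generated_subalgebra_minimal)
  with assms(1) show ?thesis by auto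
qed

text \<open>In a Lax matrix the entry (2,1) has degree 1 in the \<open>D_gen\<close>, the entry
  (1,2) degree -1 and the diagonal degree 0. Conjugating by the diagonal matrix with entries 1 and
  \<open>D_gen 1\<close> makes all degrees 0.\<close>

definition ratio_gauge :: "(('N::finite, 'n::finite) laurent)^2^2 \<Rightarrow> (('N, 'n) laurent)^2^2" where
  "ratio_gauge X = vector [vector [1, 0], vector [0, zmon (D_inv 1) 0]] ** X
     ** vector [vector [1, 0], vector [0, zmon (D_gen 1) 0]]"

lemma ratio_gauge_entries:
  "ratio_gauge X $ 1 $ 1 = X $ 1 $ 1" "ratio_gauge X $ 1 $ 2 = X $ 1 $ 2 * zmon (D_gen 1) 0"
  "ratio_gauge X $ 2 $ 1 = zmon (D_inv 1) 0 * X $ 2 $ 1"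
  "ratio_gauge X $ 2 $ 2 = zmon (D_inv 1) 0 * X $ 2 $ 2 * zmon (D_gen 1) 0"
  by (simp_all add: ratio_gauge_def matrix_matrix_mult_def sum_2)

lemma ratio_gauge_mult: "ratio_gauge (X ** Y) = ratio_gauge X ** ratio_gauge Y"
proof -
  have "vector [vector [1, 0], vector [0, zmon (D_gen 1) 0]]
      ** (vector [vector [1, 0], vector [0, zmon (D_inv 1) 0]] :: (('a, 'b) laurent)^2^2) = (mat 1 :: (('a, 'b) laurent)^2^2)"
    by (simp add: vec_eq_iff forall_2 matrix_matrix_mult_def sum_2 mat_def mult_single D_gen_inv)
  then have UU: "A ** vector [vector [1, 0], vector [0, zmon (D_gen 1) 0]]
      ** (vector [vector [1, 0], vector [0, zmon (D_inv 1) 0]] :: (('a, 'b) laurent)^2^2) = A" for A :: "(('a, 'b) laurent)^2^2"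
    by (simp only: matrix_mul_assoc[symmetric] matrix_mul_rid)
  show ?thesis
    unfolding ratio_gauge_def matrix_mul_assoc UU ..
qed

lemma ratio_gauge_shifted_lax_in_ratio_alg:
  assumes i: "i \<in> {1..CARD('n)}"
  shows "coeffs_in ratio_alg (ratio_gauge (shifted_lax k i :: (('N::finite, 'n::finite) laurent)^2^2) $ a $ b)"
proof -
  note B = subalgebra_generated[of "ratio_gens :: ('N, 'n) qalg set"]
  note D = D_ratio_in_ratio_alg[OF i, where 'N = 'N]
  note w = w_in_ratio_alg[OF i, where 'N = 'N]
  \<comment> \<open>Inserting \<open>D_gen 1 * D_inv 1\<close> splits the entry into a conjugate of
    a power of \<open>w_gen i\<close> and a ratio.\<close>
  have "D_inv 1 * (w_pow i e * D_gen i) = D_inv 1 * w_pow i e * D_gen 1 * (D_ratio i 1 :: ('N, 'n) qalg)" for e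
    by (simp add: D_ratio_def mult.assoc D_inv_commute) (simp add: D_gen_inv flip: mult.assoc)
  moreover have "D_inv 1 * w_pow i e * D_gen 1 \<in> (ratio_alg :: ('N, 'n) qalg set)" for e
    by (rule ratio_alg_conj) (use w in auto)
  ultimately have 21: "D_inv 1 * (w_pow i e * D_gen i) \<in> (ratio_alg :: ('N, 'n) qalg set)" for e
    by (simp add: subalgebra_mult[OF B] D)
  have 12: "w_pow i e * D_inv i * D_gen 1 \<in> (ratio_alg :: ('N, 'n) qalg set)" for e
    using subalgebra_mult[OF B w(3) D(1)] by (simp add: D_ratio_def D_inv_commute mult.assoc)
  have zero: "coeffs_in ratio_alg (0 :: ('N, 'n) laurent)"
    using coeffs_in_single[OF B subalgebra_0[OF B], of 0] by simp
  have 22: "D_inv 1 * x * D_gen 1 \<in> (ratio_alg :: ('N, 'n) qalg set)" if "x \<in> {0, w_gen i, w_inv i}" for x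
    by (rule ratio_alg_conj) (use that w subalgebra_0[OF B] in auto)
  show ?thesis
    using exhaust_2[of a] exhaust_2[of b]
    by (auto simp: ratio_gauge_entries shifted_lax_def mult_single left_diff_distrib right_diff_distrib 12 21 22[simplified] w subalgebra_0[OF B] zero
        intro!: coeffs_in_diff[OF B] coeffs_in_uminus[OF B] coeffs_in_single[OF B])
qed

lemma ratio_gauge_shifted_lax_prod_in_ratio_alg:
  assumes "m \<le> CARD('n)"
  shows "coeffs_in ratio_alg (ratio_gauge (shifted_lax_prod k m :: (('N::finite, 'n::finite) laurent)^2^2) $ a $ b)"
  using assms
proof (induction m arbitrary: a b)
  case 0
  note B = subalgebra_generated[of "ratio_gens :: ('N, 'n) qalg set"]
  have "ratio_gauge (mat 1) $ a $ b = (mat 1 :: (('N, 'n) laurent)^2^2) $ a $ b"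
    using exhaust_2[of a] exhaust_2[of b] by (auto simp: ratio_gauge_entries mat_def mult_single D_inv_gen)
  moreover have "coeffs_in ratio_alg ((mat 1 :: (('N, 'n) laurent)^2^2) $ a $ b)"
    using coeffs_in_single[OF B subalgebra_1[OF B], of "0 :: rat"] coeffs_in_single[OF B subalgebra_0[OF B], of "0 :: rat"]
    by (simp add: mat_def)
  ultimately show ?case by simp
next
  case (Suc m)
  then show ?case
    unfolding shifted_lax_prod.simps ratio_gauge_mult
    by (auto simp: matrix_matrix_mult_def sum_2
        intro!: coeffs_in_add[OF subalgebra_generated] coeffs_in_mult[OF subalgebra_generated] ratio_gauge_shifted_lax_in_ratio_alg)
qed

text \<open>The gauge leaves the entry (1,1) alone and conjugates the entry (2,2) by
  \<open>D_gen 1\<close>; the latter is undone inside the algebra of ratios.\<close>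

lemma twisted_trace_coeffs_in_ratio_alg:
  fixes k :: "nat \<Rightarrow> int" and \<epsilon> :: ground
  assumes "\<And>j. j \<in> {1..CARD('n)} \<Longrightarrow> k j \<in> {- 1, 0, 1}"
  shows "range (Poly_Mapping.lookup (twisted_trace \<epsilon> k :: ('N::finite, 'n::finite) laurent)) \<subseteq> ratio_alg"
proof -
  let ?S = "shifted_lax_prod k CARD('n) :: (('N, 'n) laurent)^2^2"
  note B = subalgebra_generated[of "ratio_gens :: ('N, 'n) qalg set"]
  have "coeffs_in ratio_alg (?S $ 1 $ 1)"
    using ratio_gauge_shifted_lax_prod_in_ratio_alg[of "CARD('n)" k 1 1, where 'N = 'N and 'n = 'n] by (simp add: ratio_gauge_entries)
  moreover have "coeffs_in ratio_alg (?S $ 2 $ 2)"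
    unfolding coeffs_in_def
  proof
    fix a
    let ?x = "Poly_Mapping.lookup (?S $ 2 $ 2) a"
    have "D_inv 1 * ?x * D_gen 1 \<in> ratio_alg"
      using ratio_gauge_shifted_lax_prod_in_ratio_alg[of "CARD('n)" k 2 2, where 'N = 'N and 'n = 'n]
      by (simp add: ratio_gauge_entries coeffs_in_def lookup_single_mult lookup_mult_single_0)
    then have "D_gen 1 * (D_inv 1 * ?x * D_gen 1) * D_inv 1 \<in> ratio_alg"
      by (rule ratio_alg_conj) simp
    moreover have "D_gen 1 * (D_inv 1 * ?x * D_gen 1) * D_inv 1 = (D_gen 1 * D_inv 1) * ?x * (D_gen 1 * D_inv 1)"
      by (simp only: mult.assoc)
    ultimately show "?x \<in> ratio_alg" by (simp add: D_gen_inv)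
  qed
  ultimately have "coeffs_in ratio_alg (?S $ 1 $ 1 + zmon (scalar \<epsilon>) 0 * ?S $ 2 $ 2)"
    by (intro coeffs_in_add[OF B] coeffs_in_mult[OF B] coeffs_in_single[OF B] subalgebra_scalar[OF B])
  moreover have "range (Poly_Mapping.lookup (twisted_trace \<epsilon> k :: ('N, 'n) laurent))
      = range (Poly_Mapping.lookup (?S $ 1 $ 1 + zmon (scalar \<epsilon>) 0 * ?S $ 2 $ 2))"
    by (subst twisted_trace_shifted_lax_prod, erule assms, rule lookup_shift_range)
  ultimately show ?thesis by (auto simp: coeffs_in_def)
qed

section \<open>Polynomial Lax matrices\<close>

lemma w_pow_w_pow_commute: "w_pow i a * w_pow j b = w_pow j b * w_pow i a"
  by (intro w_pow_commute; rule sym; intro w_pow_commute) (simp_all add: w_gen_commute w_inv_commute)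

lemma prod_list_commute:
  "(\<And>y. y \<in> set ys \<Longrightarrow> x * y = y * x) \<Longrightarrow> x * prod_list ys = prod_list ys * (x :: 'a::monoid_mult)"
  by (induction ys) (simp_all add: commute_mult)

lemma w_prod_commute:
  assumes "\<And>l. i \<le> l \<Longrightarrow> l \<le> j \<Longrightarrow> x * w_pow l (e l) = w_pow l (e l) * x"
  shows "x * w_prod e i j = w_prod e i j * x"
  unfolding w_prod_def by (rule prod_list_commute) (use assms in auto)

lemma w_pow_w_prod_commute: "w_pow l a * w_prod e i j = w_prod e i j * w_pow l a"
  by (rule w_prod_commute) (rule w_pow_w_pow_commute)

lemma w_prod_empty: "j < i \<Longrightarrow> w_prod e i j = 1"
  by (simp add: w_prod_def)

lemma w_prod_Suc: "i \<le> Suc j \<Longrightarrow> w_prod e i (Suc j) = w_prod e i j * w_pow (Suc j) (e (Suc j))"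
  by (simp add: w_prod_def)

lemma w_prod_single: "w_prod e i i = w_pow i (e i)"
  by (simp add: w_prod_def)

lemma w_prod_cong: "(\<And>l. i \<le> l \<Longrightarrow> l \<le> j \<Longrightarrow> e l = e' l) \<Longrightarrow> w_prod e i j = w_prod e' i j"
  unfolding w_prod_def by (rule arg_cong[of _ _ prod_list]) auto

lemma site_gens_w_prod_commute:
  assumes "x \<in> site_gens i" "i \<in> {1..CARD('n)}" "1 \<le> a" "b < i"
  shows "x * w_prod e a b = w_prod e a b * (x :: ('N::finite, 'n::finite) qalg)"
proof (rule w_prod_commute, rule w_pow_commute)
  fix l assume "a \<le> l" "l \<le> b"
  then have "l \<in> {1..CARD('n)}" "i \<noteq> l" using assms by auto
  then show "x * w_gen l = w_gen l * x" "x * w_inv l = w_inv l * x"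
    using assms site_gens_commute[of i l x] by (auto simp: site_gens_def)
qed

text \<open>\<open>shifted_lax k i\<close> without its left factor \<open>- w\<^sub>i\<close>.\<close>

definition monic_lax :: "int \<Rightarrow> nat \<Rightarrow> (('N::finite, 'n::finite) laurent)^2^2" where
  "monic_lax k i = vector
     [vector [1 - zmon (w_pow i (- 2)) 1, - zmon (w_pow i (- k - 1) * D_inv i) 1],
      vector [zmon (w_pow i (- k - 1) * D_gen i) 0,
              zmon (if k = 1 then w_pow i (- 2) else 0) 0 - zmon (if k = - 1 then 1 else 0) 1]]"

primrec monic_lax_prod :: "(nat \<Rightarrow> int) \<Rightarrow> nat \<Rightarrow> (('N::finite, 'n::finite) laurent)^2^2" where
  "monic_lax_prod k 0 = mat 1"
| "monic_lax_prod k (Suc m) = monic_lax (k (Suc m)) (Suc m) ** monic_lax_prod k m"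

lemma shifted_lax_eq_monic_lax:
  assumes "k \<in> {- 1, 0, 1}"
  shows "shifted_lax k i $ a $ b = zmon (- w_gen i) 0 * monic_lax k i $ a $ b"
proof -
  have w: "w_gen i * (w_inv i * x) = x" for x :: "('a, 'b) qalg"
    by (simp add: w_gen_inv flip: mult.assoc)
  show ?thesis
    using assms exhaust_2[of a] exhaust_2[of b]
    by (auto simp: shifted_lax_def monic_lax_def w_pow_def mult_single right_diff_distrib power2_eq_square
        mult.assoc w w_gen_inv single_uminus)
qed

lemma monic_lax_commute:
  assumes "\<And>y. y \<in> site_gens i \<Longrightarrow> x * y = y * x"
  shows "zmon x 0 * monic_lax k i $ a $ b = monic_lax k i $ a $ b * zmon x 0"
proof -
  have [simp]: "x * w_gen i = w_gen i * x" "x * w_inv i = w_inv i * x" "x * D_gen i = D_gen i * x" "x * D_inv i = D_inv i * x"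
    using assms by (auto simp: site_gens_def)
  note [simp] = w_pow_commute commute_mult
  show ?thesis
    using exhaust_2[of a] exhaust_2[of b]
    by (auto simp: monic_lax_def right_diff_distrib left_diff_distrib mult_single)
qed

text \<open>The extracted factors are not central, but the matrix of site \<open>Suc m\<close>
  commutes with the \<open>w_gen\<close> of all earlier sites, so everything gathers on the
  left.\<close>

lemma shifted_lax_prod_eq_monic_lax_prod:
  assumes "\<And>j. j \<in> {1..m} \<Longrightarrow> k j \<in> {- 1, 0, 1}" "m \<le> CARD('n)"
  shows "shifted_lax_prod k m $ a $ b = zmon ((- 1) ^ m * w_prod (\<lambda>_. 1) 1 m) 0
    * (monic_lax_prod k m $ a $ b :: ('N::finite, 'n::finite) laurent)"
  using assms
proof (induction m arbitrary: a b)
  case 0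
  show ?case by (simp add: w_prod_empty)
next
  case (Suc m)
  let ?W = "w_prod (\<lambda>_. 1) 1 m :: ('N, 'n) qalg" and ?s = "(- 1) ^ m :: ('N, 'n) qalg"
  have "zmon (?s * ?W) 0 * monic_lax (k (Suc m)) (Suc m) $ a $ c = monic_lax (k (Suc m)) (Suc m) $ a $ c * zmon (?s * ?W) 0" for c
  proof (rule monic_lax_commute)
    fix y :: "('N, 'n) qalg" assume "y \<in> site_gens (Suc m)"
    then have "y * ?W = ?W * y"
      by (rule site_gens_w_prod_commute) (use Suc.prems in auto)
    moreover have "y * ?s = ?s * y"
      by (rule commute_power) simp
    ultimately show "?s * ?W * y = y * (?s * ?W)" by (simp add: commute_mult)
  qed
  note c = this[symmetric]
  have kS: "k (Suc m) \<in> {- 1, 0, 1}" by (rule Suc.prems) simp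
  have IH: "shifted_lax_prod k m $ c $ b = zmon (?s * ?W) 0 * monic_lax_prod k m $ c $ b" for c
    by (rule Suc.IH) (use Suc.prems in auto)
  have "- w_gen (Suc m) * (?s * ?W) = (- 1) ^ Suc m * w_prod (\<lambda>_. 1) 1 (Suc m)"
  proof -
    have "- w_gen (Suc m) * (?s * ?W) = - (?s * (w_pow (Suc m) 1 * ?W))"
      using commute_power[of "w_gen (Suc m) :: ('N, 'n) qalg" "- 1" m]
      by (simp add: w_pow_def flip: mult.assoc)
    then show ?thesis by (simp add: w_prod_Suc w_pow_w_prod_commute)
  qed
  then have s: "zmon (- w_gen (Suc m)) 0 * zmon (?s * ?W) 0 = zmon ((- 1) ^ Suc m * w_prod (\<lambda>_. 1) 1 (Suc m)) (0 :: rat)"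
    by (simp only: mult_single add_0)
  have "shifted_lax (k (Suc m)) (Suc m) $ a $ c * (shifted_lax_prod k m $ c $ b :: ('N, 'n) laurent)
      = zmon ((- 1) ^ Suc m * w_prod (\<lambda>_. 1) 1 (Suc m)) 0 * (monic_lax (k (Suc m)) (Suc m) $ a $ c * monic_lax_prod k m $ c $ b)" for c
  proof -
    have "shifted_lax (k (Suc m)) (Suc m) $ a $ c * (shifted_lax_prod k m $ c $ b :: ('N, 'n) laurent)
      = zmon (- w_gen (Suc m)) 0 * (monic_lax (k (Suc m)) (Suc m) $ a $ c * zmon (?s * ?W) 0) * monic_lax_prod k m $ c $ b"
      by (simp only: shifted_lax_eq_monic_lax[OF kS] IH mult.assoc)
    also have "\<dots> = (zmon (- w_gen (Suc m)) 0 * zmon (?s * ?W) 0) * (monic_lax (k (Suc m)) (Suc m) $ a $ c * monic_lax_prod k m $ c $ b)"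
      by (simp only: c mult.assoc)
    finally show ?thesis by (simp only: s)
  qed
  then show ?case
    by (simp only: shifted_lax_prod.simps monic_lax_prod.simps matrix_matrix_mult_def sum_2 vec_lambda_beta distrib_left)
qed

text \<open>Membership in the polynomial ring in \<open>z\<close>; with rational exponents this
  excludes fractional powers as well as negative ones.\<close>

definition nonneg_powers :: "(rat \<Rightarrow>\<^sub>0 'r::ring_1) \<Rightarrow> bool" where
  "nonneg_powers f \<longleftrightarrow> Poly_Mapping.keys f \<subseteq> range of_nat"

lemma nonneg_powers_add: "nonneg_powers f \<Longrightarrow> nonneg_powers g \<Longrightarrow> nonneg_powers (f + g)"
  unfolding nonneg_powers_def using Poly_Mapping.keys_add[of f g] by blast

lemma nonneg_powers_uminus: "nonneg_powers f \<Longrightarrow> nonneg_powers (- f)"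
  by (simp add: nonneg_powers_def subset_iff in_keys_iff)

lemma nonneg_powers_diff: "nonneg_powers f \<Longrightarrow> nonneg_powers g \<Longrightarrow> nonneg_powers (f - g)"
  using nonneg_powers_add[of f "- g"] nonneg_powers_uminus[of g] by simp

lemma nonneg_powers_mult:
  assumes "nonneg_powers f" "nonneg_powers g"
  shows "nonneg_powers (f * g)"
proof -
  have "a + b \<in> range of_nat" if "a \<in> range of_nat" "b \<in> range of_nat" for a b :: rat
    using that by (auto simp flip: of_nat_add)
  then have "{a + b | a b. a \<in> Poly_Mapping.keys f \<and> b \<in> Poly_Mapping.keys g} \<subseteq> range of_nat"
    using assms unfolding nonneg_powers_def by blast
  with Poly_Mapping.keys_mult[of f g] show ?thesis unfolding nonneg_powers_def by (rule order_trans)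
qed

lemma nonneg_powers_single: "nonneg_powers (Poly_Mapping.single (of_nat a) x)"
  by (simp add: nonneg_powers_def)

lemma nonneg_powers_single_01: "nonneg_powers (Poly_Mapping.single 0 x)" "nonneg_powers (Poly_Mapping.single 1 x)"
  using nonneg_powers_single[of 0] nonneg_powers_single[of 1] by simp_all

lemma nonneg_powers_one: "nonneg_powers 1"
  using nonneg_powers_single_01(1)[of 1] by simp

lemma nonneg_powers_zero: "nonneg_powers 0"
  by (simp add: nonneg_powers_def)

text \<open>The exponent -1 turns up when the constant coefficient of \<open>z\<close> times a
  polynomial is read off.\<close>

lemma nonneg_powers_lookup: "nonneg_powers f \<Longrightarrow> Poly_Mapping.lookup f (- 1) = 0"
proof -
  assume "nonneg_powers f"
  moreover have "- 1 \<notin> range (of_nat :: nat \<Rightarrow> rat)"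
  proof
    assume "- 1 \<in> range (of_nat :: nat \<Rightarrow> rat)"
    then obtain n where "- 1 = (of_nat n :: rat)" by auto
    then have "of_nat (n + 1) = (0 :: rat)" by simp
    then show False by (simp only: of_nat_eq_0_iff)
  qed
  ultimately show ?thesis by (auto simp: nonneg_powers_def in_keys_iff)
qed

lemma nonneg_powers_monic_lax_prod: "nonneg_powers (monic_lax_prod k m $ a $ b :: ('N::finite, 'n::finite) laurent)"
proof (induction m arbitrary: a b)
  case 0
  show ?case
    by (simp add: mat_def nonneg_powers_one nonneg_powers_zero)
next
  case (Suc m)
  have "nonneg_powers (monic_lax (k (Suc m)) (Suc m) $ a $ c :: ('N, 'n) laurent)" for c
    using exhaust_2[of a] exhaust_2[of c]
    by (auto simp: monic_lax_def intro!: nonneg_powers_diff nonneg_powers_uminus nonneg_powers_single_01 nonneg_powers_one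
      nonneg_powers_zero)
  with Suc show ?case
    by (simp add: matrix_matrix_mult_def sum_2 nonneg_powers_add nonneg_powers_mult)
qed

section \<open>Expansion to first order\<close>

text \<open>At \<open>z = 0\<close> the first row of each factor is (1, 0), so the first row of the
  product is carried along and only the second one changes.\<close>

lemma lookup_monic_lax_prod_Suc_0:
  fixes k :: "nat \<Rightarrow> int"
  defines "P \<equiv> \<lambda>m. monic_lax_prod k m :: (('N::finite, 'n::finite) laurent)^2^2"
  shows "Poly_Mapping.lookup (P (Suc m) $ 1 $ b) 0 = Poly_Mapping.lookup (P m $ 1 $ b) 0"
    and "Poly_Mapping.lookup (P (Suc m) $ 2 $ b) 0
      = w_pow (Suc m) (- k (Suc m) - 1) * D_gen (Suc m) * Poly_Mapping.lookup (P m $ 1 $ b) 0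
      + (if k (Suc m) = 1 then w_pow (Suc m) (- 2) else 0) * Poly_Mapping.lookup (P m $ 2 $ b) 0"
  by (simp_all add: P_def monic_lax_def matrix_matrix_mult_def sum_2 left_diff_distrib lookup_add lookup_minus
      lookup_single_mult nonneg_powers_lookup nonneg_powers_monic_lax_prod)

lemma lookup_monic_lax_prod_Suc_1:
  fixes k :: "nat \<Rightarrow> int"
  defines "P \<equiv> \<lambda>m. monic_lax_prod k m :: (('N::finite, 'n::finite) laurent)^2^2"
  shows "Poly_Mapping.lookup (P (Suc m) $ 1 $ b) 1 = Poly_Mapping.lookup (P m $ 1 $ b) 1
      - w_pow (Suc m) (- 2) * Poly_Mapping.lookup (P m $ 1 $ b) 0
      - w_pow (Suc m) (- k (Suc m) - 1) * D_inv (Suc m) * Poly_Mapping.lookup (P m $ 2 $ b) 0"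
    and "Poly_Mapping.lookup (P (Suc m) $ 2 $ b) 1
      = w_pow (Suc m) (- k (Suc m) - 1) * D_gen (Suc m) * Poly_Mapping.lookup (P m $ 1 $ b) 1
      + (if k (Suc m) = 1 then w_pow (Suc m) (- 2) else 0) * Poly_Mapping.lookup (P m $ 2 $ b) 1
      - (if k (Suc m) = - 1 then Poly_Mapping.lookup (P m $ 2 $ b) 0 else 0)"
  by (simp_all add: P_def monic_lax_def matrix_matrix_mult_def sum_2 left_diff_distrib lookup_add lookup_minus
      lookup_single_mult)

lemma sum_Suc_1: "(\<Sum>i=1..Suc m. f i) = (\<Sum>i=1..m. f i) + f (Suc m)"
  by simp

lemma Ball_greaterThanAtMost_Suc: "i \<le> m \<Longrightarrow> (\<forall>l\<in>{i<..Suc m}. P l) \<longleftrightarrow> (\<forall>l\<in>{i<..m}. P l) \<and> P (Suc m)"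
  by (auto simp: le_Suc_eq)

lemma Ball_atLeastAtMost_Suc: "(\<forall>l\<in>{1..Suc m}. P l) \<longleftrightarrow> (\<forall>l\<in>{1..m}. P l) \<and> P (Suc m)"
  by (simp add: atLeastAtMostSuc_conv conj_commute)

context
  fixes k :: "nat \<Rightarrow> int" and P :: "nat \<Rightarrow> (('N::finite, 'n::finite) laurent)^2^2" and e :: "nat \<Rightarrow> int"
  defines "P \<equiv> monic_lax_prod k" and "e \<equiv> \<lambda>l. - k l - 1"
begin

lemma lookup_P_11_0: "Poly_Mapping.lookup (P m $ 1 $ 1) 0 = 1"
  and lookup_P_12_0: "Poly_Mapping.lookup (P m $ 1 $ 2) 0 = 0"
  by (induction m) (simp_all add: P_def lookup_monic_lax_prod_Suc_0 mat_def del: monic_lax_prod.simps(2))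

lemma e_eq: "k j = 1 \<Longrightarrow> e j = - 2"
  by (simp add: e_def)

text \<open>All factors are lower triangular at \<open>z = 0\<close>, so the corner is the product
  of the corners, and a corner vanishes unless \<open>k l = 1\<close>.\<close>

lemma lookup_P_22_0:
  "Poly_Mapping.lookup (P m $ 2 $ 2) 0 = (if \<forall>l\<in>{1..m}. k l = 1 then w_prod e 1 m else 0)"
proof (induction m)
  case 0
  show ?case by (simp add: P_def mat_def w_prod_empty)
next
  case (Suc m)
  then show ?case
    using lookup_P_12_0[of m] e_eq[of "Suc m"]
    unfolding P_def lookup_monic_lax_prod_Suc_0 Ball_atLeastAtMost_Suc
    by (auto simp: w_prod_Suc w_pow_w_prod_commute)
qed

text \<open>A matrix product is a sum over paths between the states 1 and 2, one step per site. Here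
  the path drops from 1 to 2 at site \<open>i\<close> and stays in 2 afterwards, which forces
  \<open>k l = 1\<close> at all later sites.\<close>

lemma lookup_P_21_0:
  "Poly_Mapping.lookup (P m $ 2 $ 1) 0
    = (\<Sum>i=1..m. if \<forall>l\<in>{i<..m}. k l = 1 then w_prod e i m * D_gen i else 0)"
proof (induction m)
  case 0
  show ?case by (simp add: P_def mat_def)
next
  case (Suc m)
  let ?d = "(if k (Suc m) = 1 then w_pow (Suc m) (- 2) else 0) :: ('N, 'n) qalg"
  have "?d * (if \<forall>l\<in>{i<..m}. k l = 1 then w_prod e i m * D_gen i else 0)
      = (if \<forall>l\<in>{i<..Suc m}. k l = 1 then w_prod e i (Suc m) * D_gen i else 0)" if "i \<in> {1..m}" for i
    using that e_eq[of "Suc m"]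
    by (simp add: Ball_greaterThanAtMost_Suc w_prod_Suc flip: mult.assoc)
       (simp add: w_pow_w_prod_commute)
  then have "?d * Poly_Mapping.lookup (P m $ 2 $ 1) 0
      = (\<Sum>i=1..m. if \<forall>l\<in>{i<..Suc m}. k l = 1 then w_prod e i (Suc m) * D_gen i else 0)"
    unfolding Suc.IH sum_distrib_left by (intro sum.cong refl)
  then show ?case
    using lookup_P_11_0[of m]
    unfolding P_def lookup_monic_lax_prod_Suc_0 sum_Suc_1
    by (simp add: w_prod_single e_def)
qed

text \<open>The single power of \<open>z\<close> comes either from a diagonal entry (1,1) at site
  \<open>j\<close> or from a return to state 1 at site \<open>j\<close> after a drop at an earlier
  site \<open>i\<close>, with \<open>k l = 1\<close> in between.\<close>

lemma lookup_P_11_1: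
  assumes "m \<le> CARD('n)"
  shows "Poly_Mapping.lookup (P m $ 1 $ 1) 1 = - (\<Sum>j=1..m. w_pow j (- 2))
    - (\<Sum>j=1..m. \<Sum>i=1..<j. if \<forall>l\<in>{i<..<j}. k l = 1 then w_prod e i j * D_ratio i j else 0)"
  using assms
proof (induction m)
  case 0
  show ?case by (simp add: P_def mat_def lookup_one)
next
  case (Suc m)
  let ?f = "w_pow (Suc m) (- k (Suc m) - 1) * D_inv (Suc m) :: ('N, 'n) qalg"
  have "?f * (if \<forall>l\<in>{i<..m}. k l = 1 then w_prod e i m * D_gen i else 0)
      = (if \<forall>l\<in>{i<..<Suc m}. k l = 1 then w_prod e i (Suc m) * D_ratio i (Suc m) else 0)" if "i \<in> {1..m}" for i
  proof -
    \<comment> \<open>The sites after the drop become those strictly between \<open>i\<close> and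
      the site of return.\<close>
    have s: "{i<..<Suc m} = {i<..m}" by auto
    have "D_inv (Suc m) * w_prod e i m = w_prod e i m * (D_inv (Suc m) :: ('N, 'n) qalg)"
      by (rule site_gens_w_prod_commute) (use that Suc.prems in \<open>auto simp: site_gens_def\<close>)
    then have "?f * (w_prod e i m * D_gen i) = w_pow (Suc m) (- k (Suc m) - 1) * w_prod e i m * (D_gen i * D_inv (Suc m))"
      by (simp only: mult.assoc D_inv_commute) (simp only: D_inv_commute flip: mult.assoc)
    then show ?thesis
      using that by (simp add: s D_ratio_def w_prod_Suc w_pow_w_prod_commute e_def)
  qed
  then have "?f * Poly_Mapping.lookup (P m $ 2 $ 1) 0
      = (\<Sum>i=1..<Suc m. if \<forall>l\<in>{i<..<Suc m}. k l = 1 then w_prod e i (Suc m) * D_ratio i (Suc m) else 0)"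
    unfolding lookup_P_21_0 sum_distrib_left atLeastLessThanSuc_atLeastAtMost by (intro sum.cong refl)
  then show ?case
    using lookup_P_11_0[of m] Suc
    unfolding P_def lookup_monic_lax_prod_Suc_1 sum_Suc_1
    by (simp add: algebra_simps del: sum.op_ivl_Suc)
qed

text \<open>The path stays in state 2, where \<open>k l = 1\<close>, until it rises at site
  \<open>i\<close>; the rise uses up the power of \<open>z\<close>, so the rest of the path remains
  in state 1 with weight 1.\<close>

lemma lookup_P_12_1:
  assumes "m \<le> CARD('n)"
  shows "Poly_Mapping.lookup (P m $ 1 $ 2) 1
    = - (\<Sum>i=1..m. if \<forall>l\<in>{1..<i}. k l = 1 then w_prod e 1 i * D_inv i else 0)"
  using assms
proof (induction m)
  case 0
  show ?case by (simp add: P_def mat_def)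
next
  case (Suc m)
  let ?f = "w_pow (Suc m) (- k (Suc m) - 1) * D_inv (Suc m) :: ('N, 'n) qalg"
  have "D_inv (Suc m) * w_prod e 1 m = w_prod e 1 m * (D_inv (Suc m) :: ('N, 'n) qalg)"
    by (rule site_gens_w_prod_commute) (use Suc.prems in \<open>auto simp: site_gens_def\<close>)
  then have "?f * w_prod e 1 m = w_pow (Suc m) (- k (Suc m) - 1) * w_prod e 1 m * D_inv (Suc m)"
    by (simp only: mult.assoc)
  also have "\<dots> = w_prod e 1 (Suc m) * D_inv (Suc m)"
    by (simp add: w_pow_w_prod_commute w_prod_Suc e_def)
  finally have "?f * Poly_Mapping.lookup (P m $ 2 $ 2) 0
      = (if \<forall>l\<in>{1..<Suc m}. k l = 1 then w_prod e 1 (Suc m) * D_inv (Suc m) else 0)"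
    unfolding lookup_P_22_0 atLeastLessThanSuc_atLeastAtMost by simp
  then show ?case
    using lookup_P_12_0[of m] Suc
    unfolding P_def lookup_monic_lax_prod_Suc_1 sum_Suc_1
    by simp
qed

text \<open>Either the path rises at site \<open>i\<close> and drops at a later site
  \<open>j\<close>, with \<open>k l = 1\<close> before and after, or it stays in state 2 throughout
  and picks up \<open>- z\<close> at the one site with \<open>k j = - 1\<close>.\<close>

lemma lookup_P_22_1:
  assumes "m \<le> CARD('n)"
  shows "Poly_Mapping.lookup (P m $ 2 $ 2) 1
    = - (\<Sum>j=1..m. \<Sum>i=1..<j. if (\<forall>l\<in>{1..<i}. k l = 1) \<and> (\<forall>l\<in>{j<..m}. k l = 1)
           then w_prod e 1 i * w_prod e j m * D_ratio j i else 0)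
      - (\<Sum>j=1..m. if k j = - 1 \<and> (\<forall>i\<in>{1..m}. i \<noteq> j \<longrightarrow> k i = 1)
           then w_prod (\<lambda>_. - 2) 1 (j - 1) * w_prod (\<lambda>_. - 2) (j + 1) m else 0)"
    (is "_ = - (\<Sum>j=1..m. \<Sum>i=1..<j. ?A m i j) - (\<Sum>j=1..m. ?C m j)")
  using assms
proof (induction m)
  case 0
  show ?case by (simp add: P_def mat_def lookup_one)
next
  case (Suc m)
  let ?d = "(if k (Suc m) = 1 then w_pow (Suc m) (- 2) else 0) :: ('N, 'n) qalg"
  let ?g = "w_pow (Suc m) (- k (Suc m) - 1) * D_gen (Suc m) :: ('N, 'n) qalg"
  have ww: "w_pow l a * (w_prod f i i' * w_prod f j j') = w_prod f i i' * (w_prod f j j' * (w_pow l a :: ('N, 'n) qalg))"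
    "w_pow l a * (w_prod f i i' * w_prod f j j' * x) = w_prod f i i' * (w_prod f j j' * w_pow l a) * x"
    for l a f i i' j j' and x :: "('N, 'n) qalg"
  proof -
    show *: "w_pow l a * (w_prod f i i' * w_prod f j j') = w_prod f i i' * (w_prod f j j' * (w_pow l a :: ('N, 'n) qalg))"
      using commute_mult[OF w_pow_w_prod_commute w_pow_w_prod_commute] by (simp only: mult.assoc)
    show "w_pow l a * (w_prod f i i' * w_prod f j j' * x) = w_prod f i i' * (w_prod f j j' * w_pow l a) * x"
      using arg_cong[OF *, of "\<lambda>y. y * x"] by (simp only: mult.assoc)
  qed
  \<comment> \<open>Paths already back in state 2 continue there: the new site lengthens the second
    product, and the term dies unless \<open>k (Suc m) = 1\<close>.\<close>
  have "?d * ?A m i j = ?A (Suc m) i j" if "j \<in> {1..m}" for i j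
    using that e_eq[of "Suc m"] by (simp add: Ball_greaterThanAtMost_Suc w_prod_Suc ww)
  then have dA: "?d * (\<Sum>j=1..m. \<Sum>i=1..<j. ?A m i j) = (\<Sum>j=1..m. \<Sum>i=1..<j. ?A (Suc m) i j)"
    unfolding sum_distrib_left by (intro sum.cong refl)
  have "?d * ?C m j = ?C (Suc m) j" if "j \<in> {1..m}" for j
    using that by (auto simp: Ball_atLeastAtMost_Suc w_prod_Suc ww)
  then have dC: "?d * (\<Sum>j=1..m. ?C m j) = (\<Sum>j=1..m. ?C (Suc m) j)"
    unfolding sum_distrib_left by (intro sum.cong refl)
  \<comment> \<open>These paths drop at the new site, so their second product has the single factor
    of that site.\<close>
  have "?g * (if \<forall>l\<in>{1..<i}. k l = 1 then w_prod e 1 i * D_inv i else 0) = ?A (Suc m) i (Suc m)" if "i \<in> {1..m}" for i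
  proof -
    have "D_gen (Suc m) * w_prod e 1 i = w_prod e 1 i * (D_gen (Suc m) :: ('N, 'n) qalg)"
      by (rule site_gens_w_prod_commute) (use that Suc.prems in \<open>auto simp: site_gens_def\<close>)
    then have "?g * (w_prod e 1 i * D_inv i) = w_pow (Suc m) (- k (Suc m) - 1) * w_prod e 1 i * (D_gen (Suc m) * D_inv i)"
      by (simp only: mult.assoc) (simp only: flip: mult.assoc)
    then show ?thesis
      by (simp add: D_ratio_def w_prod_single w_pow_w_prod_commute e_def)
  qed
  then have "?g * Poly_Mapping.lookup (P m $ 1 $ 2) 1 = - (\<Sum>i=1..<Suc m. ?A (Suc m) i (Suc m))"
    unfolding lookup_P_12_1[OF Suc_leD[OF Suc.prems]] mult_minus_right sum_distrib_left atLeastLessThanSuc_atLeastAtMost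
    by (intro arg_cong[of _ _ uminus] sum.cong refl)
  \<comment> \<open>Here the new site is the exceptional one, and the second product is
    empty.\<close>
  moreover have "(if k (Suc m) = - 1 then Poly_Mapping.lookup (P m $ 2 $ 2) 0 else 0) = ?C (Suc m) (Suc m)"
  proof -
    have "w_prod e 1 m = (w_prod (\<lambda>_. - 2) 1 m :: ('N, 'n) qalg)" if "\<forall>l\<in>{1..m}. k l = 1"
      by (rule w_prod_cong) (use that in \<open>auto simp: e_def\<close>)
    then show ?thesis
      unfolding lookup_P_22_0 by (auto simp: w_prod_empty le_Suc_eq)
  qed
  moreover have "?d * Poly_Mapping.lookup (P m $ 2 $ 2) 1
      = - (\<Sum>j=1..m. \<Sum>i=1..<j. ?A (Suc m) i j) - (\<Sum>j=1..m. ?C (Suc m) j)"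
    by (simp only: Suc.IH[OF Suc_leD[OF Suc.prems]] right_diff_distrib mult_minus_right dA dC)
  ultimately show ?case
    unfolding P_def lookup_monic_lax_prod_Suc_1 sum_Suc_1 by (simp only: P_def[symmetric]) (simp add: algebra_simps)
qed

end

section \<open>Matching the coefficients with the Hamiltonians\<close>

lemma sum_pairs_less:
  fixes F :: "nat \<Rightarrow> nat \<Rightarrow> 'a::comm_monoid_add"
  shows "(\<Sum>(i, j)\<in>{(i, j). 1 \<le> i \<and> i < j \<and> j \<le> n \<and> Q i j}. F i j)
    = (\<Sum>j=1..n. \<Sum>i=1..<j. if Q i j then F i j else 0)"
proof -
  have "(\<Sum>j=1..n. \<Sum>i=1..<j. if Q i j then F i j else 0) = (\<Sum>j=1..n. \<Sum>i\<in>{i\<in>{1..<j}. Q i j}. F i j)"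
    by (simp only: sum.inter_filter[OF finite_atLeastLessThan])
  also have "\<dots> = (\<Sum>(j, i)\<in>(SIGMA j:{1..n}. {i\<in>{1..<j}. Q i j}). F i j)"
    by (rule sum.Sigma) auto
  also have "\<dots> = (\<Sum>(i, j)\<in>{(i, j). 1 \<le> i \<and> i < j \<and> j \<le> n \<and> Q i j}. F i j)"
    by (rule sum.reindex_bij_witness[of _ "\<lambda>(i, j). (j, i)" "\<lambda>(j, i). (i, j)"]) auto
  finally show ?thesis ..
qed

lemma w_prod_adjacent: "w_prod e i (i + 1) = w_pow i (e i) * w_pow (i + 1) (e (i + 1))"
  using w_prod_Suc[of i i e] by (simp add: w_prod_single Suc_eq_plus1)

text \<open>\<open>H2\<close> lists neighbouring pairs separately; for them the condition on the
  sites in between is vacuous, so both sums merge.\<close>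

lemma sum_adjacent_pairs:
  fixes F :: "nat \<Rightarrow> nat \<Rightarrow> 'a::comm_monoid_add"
  assumes "\<And>i. Q i (i + 1)"
  shows "(\<Sum>i=1..<n. F i (i + 1)) + (\<Sum>(i, j)\<in>{(i, j). 1 \<le> i \<and> i + 1 < j \<and> j \<le> n \<and> Q i j}. F i j)
    = (\<Sum>j=1..n. \<Sum>i=1..<j. if Q i j then F i j else 0)"
proof -
  let ?S = "{(i, j). 1 \<le> i \<and> i + 1 < j \<and> j \<le> n \<and> Q i j}"
  have fin: "finite ?S" by (rule finite_subset[of _ "{..n} \<times> {..n}"]) auto
  have S: "{(i, j). 1 \<le> i \<and> i < j \<and> j \<le> n \<and> Q i j} = (\<lambda>i. (i, i + 1)) ` {1..<n} \<union> ?S"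
    using assms by (auto simp: image_iff Suc_eq_plus1)
  have "(\<Sum>i=1..<n. F i (i + 1)) = (\<Sum>(i, j)\<in>(\<lambda>i. (i, i + 1)) ` {1..<n}. F i j)"
    by (subst sum.reindex) (auto simp: inj_on_def)
  then show ?thesis
    unfolding sum_pairs_less[symmetric] S by (subst sum.union_disjoint) (use fin in auto)
qed

lemma monic_lax_prod_coeffs:
  fixes k :: "nat \<Rightarrow> int" and \<epsilon> :: ground
  defines "Q \<equiv> monic_lax_prod k CARD('n) $ 1 $ 1 + zmon (scalar \<epsilon>) 0 * monic_lax_prod k CARD('n) $ 2 $ 2 :: ('N::finite, 'n::finite) laurent"
  shows "Poly_Mapping.lookup Q 0 = H1 \<epsilon> k" "Poly_Mapping.lookup Q 1 = - H2 \<epsilon> k" "nonneg_powers Q"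
proof -
  let ?e = "\<lambda>l. - k l - 1" and ?n = "CARD('n)"
  have "(\<Prod>j=1..?n. if k j = 1 then 1 else 0 :: ground) = of_bool (\<forall>j\<in>{1..?n}. k j = 1)"
    by (cases "\<forall>j\<in>{1..?n}. k j = 1") auto
  moreover have "w_prod ?e 1 ?n = (w_prod (\<lambda>_. - 2) 1 ?n :: ('N, 'n) qalg)" if "\<forall>j\<in>{1..?n}. k j = 1"
    by (rule w_prod_cong) (use that in auto)
  ultimately show "Poly_Mapping.lookup Q 0 = H1 \<epsilon> k"
    by (auto simp: Q_def H1_def lookup_add lookup_single_mult lookup_P_11_0 lookup_P_22_0)
  have "(\<Sum>i=1..<?n. w_prod ?e i (i + 1) * D_ratio i (i + 1))
      + (\<Sum>(i, j)\<in>{(i, j). 1 \<le> i \<and> i + 1 < j \<and> j \<le> ?n \<and> (\<forall>l\<in>{i<..<j}. k l = 1)}. w_prod ?e i j * D_ratio i j)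
    = (\<Sum>j=1..?n. \<Sum>i=1..<j. if \<forall>l\<in>{i<..<j}. k l = 1 then w_prod ?e i j * D_ratio i j else (0 :: ('N, 'n) qalg))"
    by (rule sum_adjacent_pairs) auto
  then have 1: "(\<Sum>j=1..?n. \<Sum>i=1..<j. if \<forall>l\<in>{i<..<j}. k l = 1 then w_prod ?e i j * D_ratio i j else (0 :: ('N, 'n) qalg))
    = (\<Sum>i=1..<?n. w_pow i (?e i) * w_pow (i + 1) (?e (i + 1)) * D_ratio i (i + 1))
      + (\<Sum>(i, j)\<in>{(i, j). 1 \<le> i \<and> i + 1 < j \<and> j \<le> ?n \<and> (\<forall>l\<in>{i<..<j}. k l = 1)}. w_prod ?e i j * D_ratio i j)"
    by (simp only: w_prod_adjacent)
  have 2: "(\<Sum>j=1..?n. if k j = - 1 \<and> (\<forall>i\<in>{1..?n}. i \<noteq> j \<longrightarrow> k i = 1) then F j else 0)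
    = (\<Sum>j | 1 \<le> j \<and> j \<le> ?n \<and> k j = - 1 \<and> (\<forall>i\<in>{1..?n}. i \<noteq> j \<longrightarrow> k i = 1). F j)" for F :: "nat \<Rightarrow> ('N, 'n) qalg"
    by (subst sum.inter_filter[symmetric]) (auto intro!: sum.cong)
  show "Poly_Mapping.lookup Q 1 = - H2 \<epsilon> k"
    unfolding Q_def H2_def Let_def lookup_add lookup_single_mult diff_zero
      lookup_P_11_1[OF order_refl] lookup_P_22_1[OF order_refl] 1 2 sum_pairs_less
    by (simp add: algebra_simps)
  show "nonneg_powers Q"
    unfolding Q_def by (intro nonneg_powers_add nonneg_powers_mult nonneg_powers_monic_lax_prod nonneg_powers_single_01)
qed

text \<open>The exponents are \<open>s\<close> plus a natural number, and the subtracted terms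
  cancel exactly the coefficients at 0 and 1.\<close>

lemma nonneg_powers_remainder:
  fixes Q :: "rat \<Rightarrow>\<^sub>0 'r::ring_1"
  assumes "nonneg_powers Q"
    and a: "a \<in> Poly_Mapping.keys (Poly_Mapping.single s 1 * Q - Poly_Mapping.single s (Poly_Mapping.lookup Q 0)
      - Poly_Mapping.single (s + 1) (Poly_Mapping.lookup Q 1))"
  shows "\<exists>m::nat. m \<ge> 2 \<and> a = s + of_nat m"
proof -
  have ne: "Poly_Mapping.lookup Q (a - s) - (Poly_Mapping.lookup Q 0 when s = a) - (Poly_Mapping.lookup Q 1 when s + 1 = a) \<noteq> 0"
    using a by (simp add: in_keys_iff lookup_minus lookup_single_mult lookup_single)
  then have "a \<noteq> s" "a \<noteq> s + 1" by (auto simp: when_def)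
  with ne have "a - s \<in> Poly_Mapping.keys Q" by (simp add: in_keys_iff when_def)
  then obtain m :: nat where m: "a - s = of_nat m"
    using assms(1) by (auto simp: nonneg_powers_def)
  have "m \<noteq> 0" "m \<noteq> 1" using m \<open>a \<noteq> s\<close> \<open>a \<noteq> s + 1\<close> by (auto simp: algebra_simps)
  then show ?thesis using m by (intro exI[of _ m]) (auto simp: algebra_simps)
qed

lemma twisted_trace_expansion:
  fixes k :: "nat \<Rightarrow> int" and \<epsilon> :: ground
  assumes "\<And>j. j \<in> {1..CARD('n)} \<Longrightarrow> k j \<in> {- 1, 0, 1}"
  defines "s \<equiv> (\<Sum>j=1..CARD('n). (of_int (k j) - 1) / 2) :: rat"
  shows "\<exists>R. (\<forall>a \<in> Poly_Mapping.keys R. \<exists>m::nat. m \<ge> 2 \<and> a = s + of_nat m) \<and>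
    (twisted_trace \<epsilon> k :: ('N::finite, 'n::finite) laurent) = zmon ((- 1) ^ CARD('n) * w_prod (\<lambda>_. 1) 1 CARD('n)) 0
      * (zmon (H1 \<epsilon> k) s - zmon (H2 \<epsilon> k) (s + 1) + R)"
proof -
  let ?P = "monic_lax_prod k CARD('n) :: (('N, 'n) laurent)^2^2" and ?S = "shifted_lax_prod k CARD('n) :: (('N, 'n) laurent)^2^2"
  let ?W = "zmon ((- 1) ^ CARD('n) * w_prod (\<lambda>_. 1) 1 CARD('n)) 0 :: ('N, 'n) laurent"
  let ?E = "zmon (scalar \<epsilon>) 0 :: ('N, 'n) laurent" and ?z = "zmon 1 s :: ('N, 'n) laurent"
  define Q where "Q = ?P $ 1 $ 1 + ?E * ?P $ 2 $ 2"
  note Q = monic_lax_prod_coeffs[of k \<epsilon>, where 'N = 'N and 'n = 'n, folded Q_def]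
  have SP: "?S $ a $ b = ?W * ?P $ a $ b" for a b
    by (rule shifted_lax_prod_eq_monic_lax_prod, erule assms(1)) simp
  \<comment> \<open>\<open>?W\<close> contains the \<open>w_gen\<close> and stays on the left; it is
    the central factors \<open>?z\<close> and \<open>?E\<close> that move past it.\<close>
  have W: "?z * (?W * X) = ?W * (?z * X)" "?E * (?W * X) = ?W * (?E * X)" for X
    using central_left[OF central_single[OF central_1], of ?W s X]
      central_left[OF central_single[OF central_scalar], of ?W 0 \<epsilon> X] by simp_all
  have "twisted_trace \<epsilon> k = ?z * (?S $ 1 $ 1 + ?E * ?S $ 2 $ 2)"
    unfolding s_def by (rule twisted_trace_shifted_lax_prod, erule assms(1))
  also have "\<dots> = ?W * (?z * Q)"
    by (simp only: SP W Q_def distrib_left)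
  finally have T: "twisted_trace \<epsilon> k = ?W * (?z * Q)" .
  \<comment> \<open>The coefficient of \<open>Q\<close> at 1 is \<open>- H2 \<epsilon> k\<close>,
    which produces the minus sign in the expansion.\<close>
  let ?R = "?z * Q - zmon (Poly_Mapping.lookup Q 0) s - zmon (Poly_Mapping.lookup Q 1) (s + 1)"
  have "twisted_trace \<epsilon> k = ?W * (zmon (H1 \<epsilon> k) s - zmon (H2 \<epsilon> k) (s + 1) + ?R)"
    unfolding T Q by (simp add: single_uminus)
  moreover have "\<forall>a \<in> Poly_Mapping.keys ?R. \<exists>m::nat. m \<ge> 2 \<and> a = s + of_nat m"
    using nonneg_powers_remainder[OF Q(3)] by blast
  ultimately show ?thesis by blast
qed

theorem proposition3p26:
  fixes k :: "nat \<Rightarrow> int" and \<epsilon> :: ground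
    and T :: "('N::finite, 'n::finite) laurent" and s :: rat
  assumes "\<And>j. j \<in> {1..CARD('n)} \<Longrightarrow> k j \<in> {- 1, 0, 1}"
  defines "T \<equiv> twisted_trace \<epsilon> k"
    and "s \<equiv> (\<Sum>j=1..CARD('n). (of_int (k j) - 1) / 2)"
  shows
    "(\<forall>x \<in> generated_subalgebra (range (Poly_Mapping.lookup T)).
       \<forall>y \<in> generated_subalgebra (range (Poly_Mapping.lookup T)). x * y = y * x)
     \<and> range (Poly_Mapping.lookup T) \<subseteq>
         generated_subalgebra
           (w_gen ` {1..CARD('n)} \<union> w_inv ` {1..CARD('n)} \<union>
            (\<Union>i\<in>{1..<CARD('n)}. {D_ratio i (i + 1), D_ratio (i + 1) i}))
     \<and> (\<exists>R. (\<forall>a \<in> Poly_Mapping.keys R. \<exists>m::nat. m \<ge> 2 \<and> a = s + of_nat m) \<and>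
            T = zmon ((- 1) ^ CARD('n) * w_prod (\<lambda>_. 1) 1 CARD('n)) 0
                * (zmon (H1 \<epsilon> k) s - zmon (H2 \<epsilon> k) (s + 1) + R))"
proof (intro conjI ballI)
  fix x y
  assume "x \<in> generated_subalgebra (range (Poly_Mapping.lookup T))" "y \<in> generated_subalgebra (range (Poly_Mapping.lookup T))"
  then show "x * y = y * x"
    unfolding T_def by (rule generated_subalgebra_commute[rotated]) (rule twisted_trace_coeffs_commute, erule assms(1))
next
  show "range (Poly_Mapping.lookup T) \<subseteq>
         generated_subalgebra
           (w_gen ` {1..CARD('n)} \<union> w_inv ` {1..CARD('n)} \<union>
            (\<Union>i\<in>{1..<CARD('n)}. {D_ratio i (i + 1), D_ratio (i + 1) i}))"
    unfolding T_def ratio_gens_def[symmetric] by (rule twisted_trace_coeffs_in_ratio_alg, erule assms(1))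
next
  show "\<exists>R. (\<forall>a \<in> Poly_Mapping.keys R. \<exists>m::nat. m \<ge> 2 \<and> a = s + of_nat m) \<and>
            T = zmon ((- 1) ^ CARD('n) * w_prod (\<lambda>_. 1) 1 CARD('n)) 0
                * (zmon (H1 \<epsilon> k) s - zmon (H2 \<epsilon> k) (s + 1) + R)"
    unfolding T_def s_def by (rule twisted_trace_expansion, erule assms(1))
qed

end
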